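(* Let $d\geq 2$ and $\epsilon>0$. (i) Let $(a_n^{(1)})_{n\ge1},\ldots,(a_n^{(d)})_{n\ge1}$ be strictly increasing sequences of natural numbers, and $\boldsymbol{a}_n=(a_n^{(1)},\ldots,a_n^{(d)})$. Then for almost all $\boldsymbol{\alpha}\in[0,1]^d$ the minimal gap $\delta^{\infty}_{\min}(\boldsymbol{\alpha},N)$ of the sequence $(\{\boldsymbol{a}_n\boldsymbol{\alpha}\})_n$ satisfies $$\delta_{\min}^{\infty}(\boldsymbol{\alpha},N)\geq \frac{1}{\boldsymbol{C}_N^{1/d}(\log N)^{1/d}(\log_2 N)^{1/d+\epsilon}}\quad\text{for all sufficiently large } N.$$ (ii) Let $(a_n)_{n\ge1}$ be a sequence of distinct integers. Then for almost all $\boldsymbol{\alpha}\in[0,1]^d$ the minimal gap $\delta^{\infty}_{\min}(\boldsymbol{\alpha},N)$ of the sequence $(\{a_n\boldsymbol{\alpha}\})_n$ satisfies $$\delta_{\min}^{\infty}(\boldsymbol{\alpha},N)\leq \frac{1}{C_N^{1/d}(\log N)^{1/d}(\log_2 N)^{1/d}}\quad\text{for infinitely many } N.$$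
   Context: Notation. $\{\cdot\}$ is the fractional part, $\log_2 x=\log\log x$, and "almost all" refers to Lebesgue measure on $[0,1]^d$; "sufficiently large" may depend on $\boldsymbol{\alpha}$. For $\boldsymbol{\alpha}=(\alpha_1,\dots,\alpha_d)$ put $\{\boldsymbol{a}_n\boldsymbol{\alpha}\}=(\{a_n^{(1)}\alpha_1\},\dots,\{a_n^{(d)}\alpha_d\})$ and $\{a_n\boldsymbol{\alpha}\}=(\{a_n\alpha_1\},\dots,\{a_n\alpha_d\})$. Minimal gap: for $\boldsymbol{x}\in\mathbb{R}^d$ let $\|\boldsymbol{x}\|_\infty^{(\mathrm{nid})}=\min_{\boldsymbol{k}\in\mathbb{Z}^d}|\boldsymbol{x}+\boldsymbol{k}|_\infty$, where $|\cdot|_\infty$ is the sup norm. For a sequence $(\boldsymbol{x}_n)$ in $[0,1)^d$ the minimal gap is $\min\{\|\boldsymbol{x}_n-\boldsymbol{x}_m\|_\infty^{(\mathrm{nid})}:1\le m\ne n\le N\}$. It is denoted $\delta_{\min}^{\infty}(\boldsymbol{\alpha},N)$ when the sequence is $(\{\boldsymbol{a}_n\boldsymbol{\alpha}\})$ or $(\{a_n\boldsymbol{\alpha}\})$. Difference sets: $\boldsymbol{A}_N=\{\boldsymbol{a}_n:n\le N\}$, $(\boldsymbol{A}_N-\boldsymbol{A}_N)^+=\{\boldsymbol{c}\in\boldsymbol{A}_N-\boldsymbol{A}_N:\text{ all components } c_i>0\}$ and $\boldsymbol{C}_N=\#(\boldsymbol{A}_N-\boldsymbol{A}_N)^+$.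 Also $A_N=\{a_1,\dots,a_N\}$, $(A_N-A_N)^+=\{c>0:c=a_n-a_m\text{ for some }a_n,a_m\in A_N\}$ and $C_N=\#(A_N-A_N)^+$. *)

theory Defs
  imports "HOL-Analysis.Analysis"
begin

definition int_vec :: "int ^ 'd \<Rightarrow> real ^ 'd" where
  "int_vec k = (\<chi> i. real_of_int (k $ i))"

definition frac_vec :: "real ^ 'd \<Rightarrow> real ^ 'd" where
  "frac_vec x = (\<chi> i. frac (x $ i))"

text \<open>Distance to the nearest integer point in the sup norm. The infimum is a minimum, see
  \<open>nid_attained\<close> below.\<close>

definition nid :: "real ^ 'd::finite \<Rightarrow> real" where
  "nid x = (INF k. infnorm (x + int_vec k))"

text \<open>Only meaningful for \<open>N \<ge> 2\<close>, as otherwise the minimum is over the empty set.\<close>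

definition min_gap :: "(nat \<Rightarrow> real ^ 'd::finite) \<Rightarrow> nat \<Rightarrow> real" where
  "min_gap x N = Min {nid (x n - x m) | n m. n \<in> {1..N} \<and> m \<in> {1..N} \<and> m \<noteq> n}"

definition vec_seq :: "('d \<Rightarrow> nat \<Rightarrow> nat) \<Rightarrow> nat \<Rightarrow> int ^ 'd" where
  "vec_seq a n = (\<chi> i. int (a i n))"

definition pos_diffs_vec :: "(int ^ 'd) set \<Rightarrow> (int ^ 'd) set" where
  "pos_diffs_vec A = {c. (\<exists>x\<in>A. \<exists>y\<in>A. c = x - y) \<and> (\<forall>i. c $ i > 0)}"

definition pos_diffs :: "int set \<Rightarrow> int set" where
  "pos_diffs A = {c. c > 0 \<and> (\<exists>x\<in>A. \<exists>y\<in>A. c = x - y)}"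

definition card_pos_diffs_vec :: "(nat \<Rightarrow> int ^ 'd) \<Rightarrow> nat \<Rightarrow> nat" where
  "card_pos_diffs_vec b N = card (pos_diffs_vec (b ` {1..N}))"

definition card_pos_diffs :: "(nat \<Rightarrow> int) \<Rightarrow> nat \<Rightarrow> nat" where
  "card_pos_diffs a N = card (pos_diffs (a ` {1..N}))"

text \<open>In the vector case the product of \<open>b n\<close> and \<open>\<alpha>\<close> is componentwise.\<close>

definition min_gap_vec_seq :: "(nat \<Rightarrow> int ^ 'd::finite) \<Rightarrow> real ^ 'd \<Rightarrow> nat \<Rightarrow> real" where
  "min_gap_vec_seq b \<alpha> N = min_gap (\<lambda>n. frac_vec (int_vec (b n) * \<alpha>)) N"

definition min_gap_int_seq :: "(nat \<Rightarrow> int) \<Rightarrow> real ^ 'd::finite \<Rightarrow> nat \<Rightarrow> real" where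
  "min_gap_int_seq a \<alpha> N = min_gap (\<lambda>n. frac_vec (real_of_int (a n) *\<^sub>R \<alpha>)) N"

lemma nid_attained: "\<exists>k. nid x = infnorm (x + int_vec k)"
proof -
  define k where "k = (\<chi> i. - round (x $ i))"
  have min: "infnorm (x + int_vec k) \<le> infnorm (x + int_vec l)" for l
  proof -
    have "\<bar>(x + int_vec k) $ i\<bar> \<le> infnorm (x + int_vec l)" for i
    proof -
      have "\<bar>x $ i - of_int (round (x $ i))\<bar> \<le> \<bar>x $ i - of_int (- (l $ i))\<bar>"
        by (rule round_diff_minimal)
      then have "\<bar>(x + int_vec k) $ i\<bar> \<le> \<bar>(x + int_vec l) $ i\<bar>"
        by (simp add: int_vec_def k_def)
      also have "\<dots> \<le> infnorm (x + int_vec l)"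
        by (rule component_le_infnorm_cart)
      finally show ?thesis .
    qed
    then show ?thesis
      unfolding infnorm_cart[of "x + int_vec k"] by (intro cSup_least) auto
  qed
  have "nid x = infnorm (x + int_vec k)"
    unfolding nid_def using min by (intro cInf_eq_minimum) auto
  then show ?thesis ..
qed

end

theory Submission
  imports Defs "HOL-Real_Asymp.Real_Asymp"
begin

text \<open>
  List the positive differences in the order of their appearance, so that those of the first \<open>N\<close> terms
  are the first \<open>C\<^sub>N\<close> entries of the list. As \<open>N - 1 \<le> C\<^sub>N \<le> N\<^sup>2\<close>, the logarithms of \<open>N\<close> and \<open>C\<^sub>N\<close> are
  comparable, and both bounds concern the inequality \<open>nid (c\<^sub>j \<alpha>) < \<psi>\<^sub>j\<close> with \<open>\<psi>\<^sub>j\<^sup>d\<close> a term of a Bertrand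
  series. If the series converges, the Borel--Cantelli lemma leaves finitely many solutions \<open>j\<close>, which gives (i).

  For (ii) the series diverges and Gallagher's theorem, the Khintchine theorem in dimension \<open>d \<ge> 2\<close>
  without monotonicity, gives infinitely many solutions. In it one keeps only the points \<open>p / q\<close> with
  denominator exactly \<open>q\<close>, a positive proportion of all of them since \<open>\<Sum>n\<ge>2. 1 / n\<^sup>2 < 1\<close>. For
  different denominators such points are distinct, and then the corresponding neighbourhoods are independent
  up to a constant factor. The Chung--Erdos inequality yields a limsup set of positive measure,
  and a zero-one law for sets invariant under doubling modulo 1 makes it full.
\<close>

section \<open>Second moments, enumerations and divergent series\<close>

text \<open>Testing each difference once, against a threshold fixed by its place in the list, is
  what keeps the loss to a constant; a separate event for every \<open>N\<close> would count the
  same difference again and again. The price is that the order of appearance has nothing to do with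
  size, so in (ii) the approximation function is carried by an arbitrary set of integers and is not
  monotone. In dimension 1 divergence is then not enough, by the Duffin-Schaeffer counterexample.
  Two things can go wrong: equal points with different denominators destroy independence, and
  discarding the repetitions may leave too few points. Exact denominators cure the first in every
  dimension. The second is harmless for \<open>d >= 2\<close>, as the proportion of points discarded
  is at most the sum of \<open>1 / n^d\<close> over the divisors \<open>n >= 2\<close>. Constants do
  not matter in the end: in (i) half of \<open>\<epsilon>\<close> pays for them, in (ii) they enter
  only the factor in front of a divergent series.\<close>

lemma chung_erdos:
  fixes A :: "'i \<Rightarrow> 'a set"
  assumes fin: "finite K" and A: "\<And>k. k \<in> K \<Longrightarrow> A k \<in> fmeasurable M"
  shows "(\<Sum>k\<in>K. measure M (A k))\<^sup>2
    \<le> measure M (\<Union>k\<in>K. A k) * (\<Sum>k\<in>K. \<Sum>l\<in>K. measure M (A k \<inter> A l))"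
proof -
  define U where "U = (\<Union>k\<in>K. A k)"
  define S where "S = (\<Sum>k\<in>K. measure M (A k))"
  define T where "T = (\<Sum>k\<in>K. \<Sum>l\<in>K. measure M (A k \<inter> A l))"
  define f :: "'a \<Rightarrow> real" where "f x = (\<Sum>k\<in>K. indicator (A k) x)" for x
  have U: "U \<in> fmeasurable M"
    unfolding U_def using fin A by (intro fmeasurable.finite_UN) auto
  have ind: "has_bochner_integral M (indicator B :: 'a \<Rightarrow> real) (measure M B)"
    if "B \<in> fmeasurable M" for B
    using that by (intro has_bochner_integral_real_indicator) (auto simp: fmeasurable_def)
  have f: "has_bochner_integral M f S"
    unfolding f_def S_def using A ind by (intro has_bochner_integral_sum) auto
  have f2_eq: "(f x)\<^sup>2 = (\<Sum>k\<in>K. \<Sum>l\<in>K. indicator (A k \<inter> A l) x)" for x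
    by (simp add: f_def power2_eq_square sum_product indicator_inter_arith)
  have f2: "has_bochner_integral M (\<lambda>x. (f x)\<^sup>2) T"
    unfolding f2_eq T_def using A ind
    by (intro has_bochner_integral_sum ind fmeasurable.Int) auto
  \<comment> \<open>Cauchy-Schwarz in discriminant form: \<open>f\<close> vanishes off
    \<open>U\<close>, so the expression is the integral of the square of
    \<open>indicator U - c * f\<close>. The best choice is \<open>c = S / T\<close>.\<close>
  have quadratic: "0 \<le> measure M U - 2 * c * S + c\<^sup>2 * T" for c :: real
  proof -
    have "has_bochner_integral M (\<lambda>x. indicator U x - (2 * c) * f x + c\<^sup>2 * (f x)\<^sup>2)
            (measure M U - (2 * c) * S + c\<^sup>2 * T)"
      by (intro has_bochner_integral_add has_bochner_integral_diff
          has_bochner_integral_mult_right f f2 ind U)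
    moreover have "0 \<le> indicator U x - (2 * c) * f x + c\<^sup>2 * (f x)\<^sup>2" for x
    proof (cases "x \<in> U")
      case True
      then have "indicator U x - (2 * c) * f x + c\<^sup>2 * (f x)\<^sup>2 = (1 - c * f x)\<^sup>2"
        by (simp add: power2_eq_square algebra_simps)
      then show ?thesis by simp
    next
      case False
      then have "f x = 0" by (auto simp: f_def U_def indicator_def intro!: sum.neutral)
      then show ?thesis by simp
    qed
    ultimately show ?thesis
      by (metis (no_types, lifting) has_bochner_integral_iff integral_nonneg_AE AE_I2)
  qed
  have "S \<le> T"
    unfolding S_def T_def
  proof (rule sum_mono)
    fix k assume "k \<in> K"
    then have "measure M (A k \<inter> A k) \<le> (\<Sum>l\<in>K. measure M (A k \<inter> A l))"
      using fin by (intro member_le_sum) auto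
    then show "measure M (A k) \<le> (\<Sum>l\<in>K. measure M (A k \<inter> A l))" by simp
  qed
  moreover have "0 \<le> S" unfolding S_def by (simp add: sum_nonneg)
  ultimately consider "S = 0" "T = 0" | "T > 0" by linarith
  then have "S\<^sup>2 \<le> measure M U * T"
  proof cases
    case 2
    have "0 \<le> (measure M U - 2 * (S / T) * S + (S / T)\<^sup>2 * T) * T"
      using quadratic[of "S / T"] 2 by (intro mult_nonneg_nonneg) auto
    also have "\<dots> = measure M U * T - S\<^sup>2"
      using 2 by (simp add: field_simps power2_eq_square)
    finally show ?thesis by simp
  qed simp
  then show ?thesis by (simp only: S_def T_def U_def)
qed

text \<open>Each set is listed by appending its new elements to the list of the previous set, so a
  position never changes once filled. The point is that one fixed sequence serves all the sets:
  \<open>e j\<close> lies in \<open>D n\<close> exactly when \<open>j < card (D n)\<close>.\<close>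

lemma enumerate_chain:
  fixes D :: "nat \<Rightarrow> 'a set"
  assumes mono: "mono D" and fin: "\<And>n. finite (D n)"
    and unbounded: "\<And>m. \<exists>n. m < card (D n)"
  obtains e :: "nat \<Rightarrow> 'a" where "inj e" "\<And>n. D n = e ` {..<card (D n)}"
proof -
  have "\<exists>ys. distinct (xs @ ys) \<and> set (xs @ ys) = D (Suc n)"
    if "distinct xs" "set xs = D n" for xs n
  proof -
    obtain ys where ys: "set ys = D (Suc n) - D n" "distinct ys"
      using finite_distinct_list fin finite_Diff by metis
    then show ?thesis
      using that monoD[OF mono, of n "Suc n"] by (intro exI[of _ ys]) auto
  qed
  then have step: "\<exists>zs. (distinct zs \<and> set zs = D (Suc n)) \<and> (\<exists>ys. zs = xs @ ys)"
    if "distinct xs \<and> set xs = D n" for xs n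
    using that by blast
  have "\<exists>xs. distinct xs \<and> set xs = D 0"
    using finite_distinct_list fin by metis
  then obtain L where L: "\<And>n. distinct (L n) \<and> set (L n) = D n"
    and prefix: "\<And>n. \<exists>ys. L (Suc n) = L n @ ys"
    using dependent_nat_choice[of "\<lambda>n xs. distinct xs \<and> set xs = D n"
        "\<lambda>n xs zs. \<exists>ys. zs = xs @ ys"] step by metis
  have prefix_mono: "\<exists>ys. L n = L m @ ys" if "m \<le> n" for m n
    using that
  proof (induction rule: dec_induct)
    case (step n)
    then show ?case using prefix[of n] by (metis append.assoc)
  qed simp
  have len: "length (L n) = card (D n)" for n
    using L[of n] by (metis distinct_card)
  \<comment> \<open>The first list that is long enough; by the prefix property every later one has
    the same entry.\<close>
  define e where "e j = L (LEAST n. j < card (D n)) ! j" for j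
  have e: "e j = L n ! j" if "j < card (D n)" for j n
  proof -
    define m where "m = (LEAST n. j < card (D n))"
    have "m \<le> n" "j < card (D m)"
      using that unfolding m_def by (auto intro: Least_le LeastI)
    then show ?thesis
      using prefix_mono[of m n] len[of m] by (auto simp: e_def nth_append simp flip: m_def)
  qed
  show thesis
  proof
    show "D n = e ` {..<card (D n)}" for n
    proof -
      have "D n = (\<lambda>j. L n ! j) ` {..<card (D n)}"
        using L[of n] len[of n] by (auto simp: set_conv_nth image_iff)
      then show ?thesis using e by auto
    qed
    show "inj e"
    proof (rule injI)
      fix i j assume eq: "e i = e j"
      obtain n where n: "max i j < card (D n)" using unbounded by blast
      then have "L n ! i = L n ! j" using eq e by auto
      then show "i = j" using n L[of n] len[of n] by (simp add: nth_eq_iff_index_eq)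
    qed
  qed
qed

text \<open>Divide each term by the partial sum that includes it. The weights tend to 0, and the new
  series still diverges since a block over which the partial sum doubles contributes at least
  1/2.\<close>

lemma abel_dini:
  fixes u :: "nat \<Rightarrow> real"
  assumes nonneg: "\<And>n. 0 \<le> u n" and div: "\<not> summable u"
  obtains \<eta> :: "nat \<Rightarrow> real" where "\<And>n. 0 < \<eta> n" "\<And>n. \<eta> n \<le> 1" "\<eta> \<longlonglongrightarrow> 0" "\<not> summable (\<lambda>n. \<eta> n * u n)"
proof -
  \<comment> \<open>The summand 1 keeps \<open>s\<close> away from 0 and bounds the weights
    \<open>1 / s (Suc n)\<close> by 1.\<close>
  define s where "s n = 1 + (\<Sum>k<n. u k)" for n
  have s_pos: "0 < s n" for n
    using nonneg by (simp add: s_def add_pos_nonneg sum_nonneg)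
  have s_mono: "s m \<le> s n" if "m \<le> n" for m n
    unfolding s_def using that nonneg by (auto intro!: sum_mono2)
  have s_top: "filterlim s at_top sequentially"
  proof -
    have "filterlim (\<lambda>n. \<Sum>k<n. u k) at_top sequentially"
      unfolding filterlim_at_top
    proof
      fix Z :: real
      have "\<exists>N. Z < (\<Sum>k<N. u k)"
      proof (rule ccontr)
        assume "\<not> ?thesis"
        then have "\<And>n. (\<Sum>k<n. u k) \<le> Z" by (simp add: not_less)
        then show False using div nonneg bounded_imp_summable[of u Z]
          by (metis lessThan_Suc_atMost)
      qed
      then obtain N where N: "Z < (\<Sum>k<N. u k)" ..
      have "(\<Sum>k<N. u k) \<le> (\<Sum>k<n. u k)" if "N \<le> n" for n
        using that nonneg by (intro sum_mono2) auto
      then show "\<forall>\<^sub>F n in sequentially. Z \<le> (\<Sum>k<n. u k)"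
        using N unfolding eventually_sequentially by (meson order_less_imp_le order_trans)
    qed
    then show ?thesis unfolding s_def
      by (rule filterlim_tendsto_add_at_top[OF tendsto_const])
  qed
  show thesis
  proof
    show "0 < 1 / s (Suc n)" for n using s_pos by simp
    show "1 / s (Suc n) \<le> 1" for n using s_mono[of 0 "Suc n"] by (simp add: s_def)
    have "(\<lambda>n. inverse (s n)) \<longlonglongrightarrow> 0"
      by (rule tendsto_inverse_0_at_top[OF s_top])
    then show "(\<lambda>n. 1 / s (Suc n)) \<longlonglongrightarrow> 0"
      using LIMSEQ_Suc by (simp add: inverse_eq_divide)
    show "\<not> summable (\<lambda>n. 1 / s (Suc n) * u n)"
    proof
      assume "summable (\<lambda>n. 1 / s (Suc n) * u n)"
      then obtain N where N: "\<And>m n. N \<le> m \<Longrightarrow> norm (\<Sum>k\<in>{m..<n}. 1 / s (Suc k) * u k) < 1 / 2"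
        unfolding summable_Cauchy by (meson half_gt_zero zero_less_one)
      obtain n where n: "N \<le> n" "2 * s N \<le> s n"
        using s_top unfolding filterlim_at_top eventually_sequentially by (meson linear order.trans)
      have "1 / 2 \<le> (s n - s N) / s n"
        using n s_pos[of n] by (simp add: field_simps)
      also have "s n - s N = (\<Sum>k\<in>{N..<n}. u k)"
        unfolding s_def using n(1)
        by (simp add: sum_diff_nat_ivl[of 0 N n, simplified] lessThan_atLeast0)
      also have "(\<Sum>k\<in>{N..<n}. u k) / s n \<le> (\<Sum>k\<in>{N..<n}. 1 / s (Suc k) * u k)"
        unfolding sum_divide_distrib
      proof (rule sum_mono)
        fix k assume k: "k \<in> {N..<n}"
        then show "u k / s n \<le> 1 / s (Suc k) * u k"
          using s_mono[of "Suc k" n] s_pos[of "Suc k"] nonneg[of k]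
          by (simp add: divide_left_mono)
      qed
      also have "\<dots> < 1 / 2" using N[of N n] by auto
      finally show False by simp
    qed
  qed
qed

section \<open>Counting reduced fractions\<close>

text \<open>The value 3/4 is the first term 1/4 plus the telescoping majorant 1/2 of the rest; the
  induction has to carry the unspent part \<open>1 / m\<close>. That it is below 1 leaves the
  proportion 1/4 in \<open>card_primitive_ge\<close>.\<close>

lemma sum_inverse_squares_le:
  assumes "m \<ge> 1"
  shows "(\<Sum>n=2..m. 1 / (real n)\<^sup>2) \<le> 3 / 4"
proof -
  have "(\<Sum>n=2..m. 1 / (real n)\<^sup>2) \<le> 3 / 4 - 1 / real m" if "m \<ge> 2"
    using that
  proof (induction m rule: dec_induct)
    case (step m)
    have "1 / (real (Suc m))\<^sup>2 \<le> 1 / real m - 1 / real (Suc m)"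
    proof -
      have "1 / (real (Suc m))\<^sup>2 \<le> 1 / (real m * real (Suc m))"
        using step.hyps unfolding power2_eq_square by (intro divide_left_mono mult_right_mono) auto
      also have "\<dots> = 1 / real m - 1 / real (Suc m)"
        using step.hyps by (simp add: field_simps)
      finally show ?thesis .
    qed
    then show ?case using step by simp
  qed simp
  moreover have "(\<Sum>n=2..m. 1 / (real n)\<^sup>2) = 0" if "\<not> m \<ge> 2"
    using that by simp
  moreover have "1 / real m \<ge> 0" by simp
  ultimately show ?thesis by linarith
qed

lemma vec_Collect_eq_image_PiE:
  "{p :: 'a ^ 'd::finite. \<forall>i. p $ i \<in> S i} = vec_lambda ` PiE UNIV S"
proof (intro equalityI subsetI)
  fix p :: "'a ^ 'd" assume "p \<in> {p. \<forall>i. p $ i \<in> S i}"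
  then show "p \<in> vec_lambda ` PiE UNIV S"
    by (intro image_eqI[of _ _ "\<lambda>i. p $ i"]) auto
qed (auto simp: PiE_iff)

lemma card_vec_Collect:
  "card {p :: 'a ^ 'd::finite. \<forall>i. p $ i \<in> S i} = (\<Prod>i\<in>UNIV. card (S i))"
proof -
  have "inj_on vec_lambda (PiE UNIV S)"
    by (intro inj_onI) (metis vec_lambda_inverse UNIV_I)
  then show ?thesis
    by (simp add: vec_Collect_eq_image_PiE card_image card_PiE)
qed

lemma finite_vec_Collect:
  assumes "\<And>i. finite (S i)"
  shows "finite {p :: 'a ^ 'd::finite. \<forall>i. p $ i \<in> S i}"
  unfolding vec_Collect_eq_image_PiE using assms by (intro finite_imageI finite_PiE) auto

text \<open>Numerators of the points of \<open>[0,1)\<^sup>d\<close> whose exact common denominator is \<open>q\<close>.\<close>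

definition primitive :: "nat \<Rightarrow> (int ^ 'd) set" where
  "primitive q = {p. (\<forall>i. p $ i \<in> {0..<int q}) \<and>
     (\<forall>n. n dvd q \<and> (\<forall>i. int n dvd p $ i) \<longrightarrow> n = 1)}"

lemma finite_primitive: "finite (primitive q :: (int ^ 'd::finite) set)"
  by (rule finite_subset[OF _ finite_vec_Collect[of "\<lambda>_. {0..<int q}"]])
     (auto simp: primitive_def)

lemma card_multiples_lessThan:
  assumes "n dvd q" "n > 0"
  shows "card {x \<in> {0..<int q}. int n dvd x} = q div n"
proof -
  obtain m where m: "q = n * m" using assms by blast
  have "{x \<in> {0..<int q}. int n dvd x} = (\<lambda>k. int n * k) ` {0..<int m}"
    using assms(2) by (auto simp: m image_iff zero_le_mult_iff dvd_def)
  moreover have "inj_on (\<lambda>k. int n * k) {0..<int m}"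
    using assms(2) by (auto intro: inj_onI)
  ultimately show ?thesis using assms(2) by (simp add: m card_image)
qed

text \<open>Union bound over the divisors \<open>n >= 2\<close> of \<open>q\<close>: the numerators
  divisible by \<open>n\<close> in all coordinates form a fraction
  \<open>1 / n^d <= 1 / n^2\<close>. This is where the dimension enters; for \<open>d = 1\<close>
  the count is Euler's totient, which is not bounded below by a fixed positive multiple of
  \<open>q\<close>.\<close>

lemma card_primitive_ge:
  assumes d: "CARD('d::finite) \<ge> 2" and q: "q > 0"
  shows "real q ^ CARD('d) / 4 \<le> real (card (primitive q :: (int ^ 'd) set))"
proof -
  define All :: "(int ^ 'd) set" where "All = {p. \<forall>i. p $ i \<in> {0..<int q}}"
  define Bad :: "nat \<Rightarrow> (int ^ 'd) set"
    where "Bad n = {p. \<forall>i. p $ i \<in> {x \<in> {0..<int q}. int n dvd x}}" for n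
  define Ds where "Ds = {n \<in> {2..q}. n dvd q}"
  have fin_All: "finite All" unfolding All_def by (intro finite_vec_Collect) simp
  have fin_Bad: "finite (Bad n)" for n unfolding Bad_def by (intro finite_vec_Collect finite_Collect_conjI disjI1) simp
  have "All \<subseteq> primitive q \<union> (\<Union>n\<in>Ds. Bad n)"
  proof
    fix p assume p: "p \<in> All"
    show "p \<in> primitive q \<union> (\<Union>n\<in>Ds. Bad n)"
    proof (cases "p \<in> primitive q")
      case False
      then obtain n where n: "n dvd q" "\<And>i. int n dvd p $ i" "n \<noteq> 1"
        using p by (auto simp: All_def primitive_def)
      moreover have "n \<noteq> 0" using n(1) q by auto
      ultimately have "n \<in> Ds" using q by (auto simp: Ds_def dvd_imp_le)
      then show ?thesis using n(2) p by (auto simp: All_def Bad_def)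
    qed simp
  qed
  then have "card All \<le> card (primitive q \<union> (\<Union>n\<in>Ds. Bad n))"
    using fin_Bad by (intro card_mono) (auto simp: Ds_def finite_primitive)
  also have "\<dots> \<le> card (primitive q :: (int ^ 'd) set) + card (\<Union>n\<in>Ds. Bad n)"
    by (rule card_Un_le)
  also have "card (\<Union>n\<in>Ds. Bad n) \<le> (\<Sum>n\<in>Ds. card (Bad n))"
    by (intro card_UN_le) (simp add: Ds_def)
  finally have "card All \<le> card (primitive q :: (int ^ 'd) set) + (\<Sum>n\<in>Ds. card (Bad n))"
    by simp
  then have le: "real (card All) \<le> real (card (primitive q :: (int ^ 'd) set)) + (\<Sum>n\<in>Ds. real (card (Bad n)))"
    by (simp only: flip: of_nat_sum of_nat_add of_nat_le_iff)
  have "(\<Sum>n\<in>Ds. real (card (Bad n))) \<le> (\<Sum>n\<in>Ds. real q ^ CARD('d) * (1 / (real n)\<^sup>2))"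
  proof (rule sum_mono)
    fix n assume n: "n \<in> Ds"
    then have *: "n dvd q" "n > 0" by (auto simp: Ds_def)
    then have "real (card (Bad n)) = (real q / real n) ^ CARD('d)"
      unfolding Bad_def card_vec_Collect card_multiples_lessThan[OF *] by (simp add: real_of_nat_div)
    also have "\<dots> \<le> real q ^ CARD('d) / (real n)\<^sup>2"
      using d * by (simp add: power_divide frac_le power_increasing)
    finally show "real (card (Bad n)) \<le> real q ^ CARD('d) * (1 / (real n)\<^sup>2)" by simp
  qed
  also have "\<dots> = real q ^ CARD('d) * (\<Sum>n\<in>Ds. 1 / (real n)\<^sup>2)"
    by (simp add: sum_distrib_left)
  also have "\<dots> \<le> real q ^ CARD('d) * (\<Sum>n=2..q. 1 / (real n)\<^sup>2)"
    by (intro mult_left_mono sum_mono2) (auto simp: Ds_def)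
  also have "\<dots> \<le> real q ^ CARD('d) * (3 / 4)"
    using q by (intro mult_left_mono sum_inverse_squares_le) auto
  finally have "(\<Sum>n\<in>Ds. real (card (Bad n))) \<le> real q ^ CARD('d) * (3 / 4)" .
  moreover have "real (card All) = real q ^ CARD('d)"
    unfolding All_def card_vec_Collect by simp
  ultimately show ?thesis using le by simp
qed

text \<open>The hypothesis \<open>eq\<close> says that \<open>p / q\<close> and
  \<open>p' / r\<close> are the same point. After cancelling the gcd, the cofactor of
  \<open>q\<close> divides every coordinate of \<open>p\<close> as well as \<open>q\<close>, so it
  is 1 by primitivity, and likewise for \<open>r\<close>.\<close>

lemma primitive_denominator_unique:
  fixes p p' :: "int ^ 'd"
  assumes p: "p \<in> primitive q" "p' \<in> primitive r" and pos: "q > 0" "r > 0"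
    and eq: "\<And>i. p $ i * int r = p' $ i * int q"
  shows "q = r"
proof -
  define g where "g = gcd q r"
  obtain q' r' where qr: "q = g * q'" "r = g * r'" and cop: "coprime q' r'"
    using gcd_coprime_exists[of q r] pos unfolding g_def by (metis gcd_eq_0_iff mult.commute not_gr0)
  have "g > 0" using pos by (simp add: g_def)
  have eq': "p $ i * int r' = p' $ i * int q'" for i
    using eq[of i] \<open>g > 0\<close> by (simp add: qr)
  have "int q' dvd p $ i * int r'" "int r' dvd p' $ i * int q'" for i
    using eq'[of i] by (metis dvd_triv_right)+
  then have "int q' dvd p $ i" "int r' dvd p' $ i" for i
    using cop by (simp_all add: coprime_dvd_mult_left_iff coprime_commute)
  moreover have "q' dvd q" "r' dvd r" by (simp_all add: qr)
  ultimately have "q' = 1" "r' = 1" using p by (auto simp: primitive_def)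
  then show ?thesis by (simp add: qr)
qed

text \<open>\<open>a / q - b / r\<close> is determined by \<open>(a r - b q) / gcd q r\<close>, and the pairs \<open>(a, b)\<close> with a given
  difference are told apart by the quotient of \<open>a\<close> by \<open>q / gcd q r\<close>.\<close>

lemma card_close_fractions_le:
  fixes K :: real
  assumes pos: "q > 0" "r > 0" and K: "real (gcd q r) \<le> K"
  shows "real (card {(a, b). a \<in> {0..<int q} \<and> b \<in> {0..<int r} \<and>
      \<bar>real_of_int (a * int r - b * int q)\<bar> \<le> K}) \<le> 3 * K" (is "real (card ?P) \<le> _")
proof -
  define g where "g = gcd q r"
  obtain q' r' where qr: "q = g * q'" "r = g * r'" and cop: "coprime q' r'"
    using gcd_coprime_exists[of q r] pos unfolding g_def by (metis gcd_eq_0_iff mult.commute not_gr0)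
  have g: "g > 0" and q': "q' > 0" using pos qr by auto
  \<comment> \<open>\<open>m\<close> bounds the reduced difference. As \<open>K\<close> is at least
    the gcd, \<open>m >= 1\<close> and hence \<open>2 * m + 1 <= 3 * m\<close>; this is the origin
    of the factor 3.\<close>
  define m where "m = \<lfloor>K / real g\<rfloor>"
  have m: "m \<ge> 1" using K g by (simp add: m_def g_def[symmetric] le_floor_iff)
  define F where "F = (\<lambda>(a, b). (a * int r' - b * int q', a div int q'))"
  have "inj_on F ?P"
  proof (rule inj_onI, clarify)
    fix a b a2 b2 assume F: "F (a, b) = F (a2, b2)"
    have diff: "(a - a2) * int r' = (b - b2) * int q'" and div: "a div int q' = a2 div int q'"
      using F by (auto simp: F_def algebra_simps)
    have "int q' dvd (a - a2) * int r'" by (simp add: diff)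
    then have "int q' dvd a - a2" using cop by (simp add: coprime_dvd_mult_left_iff)
    then have "a mod int q' = a2 mod int q'" by (simp add: mod_eq_dvd_iff)
    then have "a = a2" using div by (metis mult_div_mod_eq)
    then show "a = a2 \<and> b = b2" using diff q' by simp
  qed
  moreover have "F ` ?P \<subseteq> {-m..m} \<times> {0..<int g}"
  proof (rule image_subsetI)
    fix z assume "z \<in> ?P"
    then obtain a b where z: "z = (a, b)"
      and ab: "a \<in> {0..<int q}" "\<bar>real_of_int (a * int r - b * int q)\<bar> \<le> K"
      by auto
    have "real_of_int (a * int r - b * int q) = real g * real_of_int (a * int r' - b * int q')"
      by (simp add: qr ring_distribs mult.assoc mult.left_commute)
    then have "real g * \<bar>real_of_int (a * int r' - b * int q')\<bar> \<le> K"
      using ab(2) by (simp only: abs_mult abs_of_nat)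
    then have "\<bar>real_of_int (a * int r' - b * int q')\<bar> \<le> K / real g"
      using g by (simp add: pos_le_divide_eq mult.commute)
    then have "\<bar>a * int r' - b * int q'\<bar> \<le> m"
      by (simp add: m_def le_floor_iff)
    moreover have "a div int q' < int g"
    proof (rule ccontr)
      assume "\<not> a div int q' < int g"
      then have "int g * int q' \<le> a div int q' * int q'" by (intro mult_right_mono) auto
      also have "\<dots> \<le> a" using q' by (simp add: div_mult_mod_eq minus_mod_eq_div_mult[symmetric])
      finally show False using ab(1) by (simp add: qr)
    qed
    moreover have "0 \<le> a div int q'"
      using ab(1) q' by (simp add: pos_imp_zdiv_nonneg_iff)
    ultimately show "F z \<in> {-m..m} \<times> {0..<int g}" by (auto simp: F_def z)
  qed
  ultimately have "card ?P \<le> card ({-m..m} \<times> {0..<int g})"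
    by (rule card_inj_on_le) simp
  also have "card ({-m..m} \<times> {0..<int g}) = nat (2 * m + 1) * g"
    by (simp add: card_cartesian_product)
  finally have "real (card ?P) \<le> real (nat (2 * m + 1) * g)"
    by (simp only: of_nat_le_iff)
  also have "\<dots> = real_of_int (2 * m + 1) * real g"
    using m by (simp add: of_nat_nat)
  also have "\<dots> \<le> real_of_int (3 * m) * real g"
    using m by (intro mult_right_mono) auto
  also have "\<dots> = 3 * (real_of_int m * real g)" by simp
  also have "real_of_int m * real g \<le> K / real g * real g"
    unfolding m_def by (intro mult_right_mono of_int_floor_le) auto
  also have "\<dots> = K" using g by simp
  finally show ?thesis by simp
qed

section \<open>Distance to the integer lattice and the zero-one law\<close>

lemma int_vec_diff: "int_vec (k - l) = int_vec k - int_vec l"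
  by (simp add: int_vec_def vec_eq_iff)

lemma int_vec_uminus: "int_vec (- k) = - int_vec k"
  by (simp add: int_vec_def vec_eq_iff)

lemma int_vec_scaleR: "real n *\<^sub>R int_vec k = int_vec (\<chi> i. int n * k $ i)"
  by (simp add: int_vec_def vec_eq_iff)

lemma infnorm_less_iff: "infnorm (x :: real ^ 'd::finite) < t \<longleftrightarrow> (\<forall>i. \<bar>x $ i\<bar> < t)"
proof -
  have "infnorm x = Max (range (\<lambda>i. \<bar>x $ i\<bar>))"
    unfolding infnorm_cart by (subst cSup_eq_Max) (auto simp: full_SetCompr_eq)
  then show ?thesis by simp
qed

lemma nid_le: "nid x \<le> infnorm (x + int_vec k)"
  unfolding nid_def by (rule cINF_lower) (auto intro!: bdd_belowI[of _ 0] simp: infnorm_pos_le)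

lemma nid_nonneg: "0 \<le> nid x"
  using nid_attained[of x] by (auto simp: infnorm_pos_le)

lemma nid_less_iff: "nid x < t \<longleftrightarrow> (\<exists>k. infnorm (x + int_vec k) < t)"
  using nid_attained[of x] nid_le[of x] by (metis le_less_trans)

lemma nid_add_int_vec [simp]: "nid (x + int_vec k) = nid x"
proof -
  have "nid (x + int_vec k) \<le> nid x" for x :: "real ^ 'd" and k
  proof -
    obtain l where "nid x = infnorm (x + int_vec l)" using nid_attained by blast
    also have "x + int_vec l = (x + int_vec k) + int_vec (l - k)"
      by (simp add: int_vec_diff)
    finally show ?thesis using nid_le[of "x + int_vec k" "l - k"] by simp
  qed
  from this[of x k] this[of "x + int_vec k" "- k"] show ?thesis
    by (simp add: int_vec_uminus)
qed

lemma nid_minus: "nid (- x) = nid x"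
proof -
  have "nid (- x) \<le> nid x" for x :: "real ^ 'd"
  proof -
    obtain l where "nid x = infnorm (x + int_vec l)" using nid_attained by blast
    also have "\<dots> = infnorm (- x + int_vec (- l))"
      by (metis infnorm_neg int_vec_uminus minus_add_distrib)
    finally show ?thesis using nid_le[of "- x" "- l"] by simp
  qed
  from this[of x] this[of "- x"] show ?thesis by simp
qed

lemma nid_scaleR_le: "nid (real n *\<^sub>R x) \<le> real n * nid x"
proof -
  obtain l where l: "nid x = infnorm (x + int_vec l)" using nid_attained by blast
  have "nid (real n *\<^sub>R x) \<le> infnorm (real n *\<^sub>R x + int_vec (\<chi> i. int n * l $ i))"
    by (rule nid_le)
  also have "\<dots> = infnorm (real n *\<^sub>R (x + int_vec l))"
    by (simp add: scaleR_add_right int_vec_scaleR)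
  also have "\<dots> = real n * nid x" by (simp add: infnorm_mul l)
  finally show ?thesis .
qed

lemma open_nid_less:
  fixes f :: "'a::topological_space \<Rightarrow> real ^ 'd::finite"
  assumes "continuous_on UNIV f"
  shows "open {x. nid (f x) < t}"
proof -
  have "{x. nid (f x) < t} = (\<Union>k. {x. infnorm (f x + int_vec k) < t})"
    by (auto simp: nid_less_iff)
  moreover have "open {x. infnorm (f x + int_vec k) < t}" for k
    using assms by (intro open_Collect_less continuous_intros)
  ultimately show ?thesis by auto
qed

section \<open>Periodic sets and doubling modulo 1\<close>

definition int_periodic :: "(real ^ 'd) set \<Rightarrow> bool" where
  "int_periodic S \<longleftrightarrow> (\<forall>x k. x + int_vec k \<in> S \<longleftrightarrow> x \<in> S)"

lemma int_periodic_uminus: "int_periodic S \<Longrightarrow> int_periodic (- S)"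
  by (simp add: int_periodic_def)

lemma negligible_int_periodic:
  fixes S :: "(real ^ 'd::finite) set"
  assumes S: "int_periodic S" and neg: "negligible (S \<inter> cbox 0 1)"
  shows "negligible S"
proof -
  have "S \<subseteq> (\<Union>k. (+) (int_vec k) ` (S \<inter> cbox 0 1))"
  proof
    fix x assume "x \<in> S"
    define k :: "int ^ 'd" where "k = (\<chi> i. \<lfloor>x $ i\<rfloor>)"
    have "x - int_vec k = x + int_vec (- k)" by (simp add: int_vec_uminus)
    then have "x - int_vec k \<in> S" using S \<open>x \<in> S\<close> by (simp only: int_periodic_def)
    moreover have "x - int_vec k \<in> cbox 0 1"
      by (auto simp: mem_box_cart int_vec_def k_def) linarith+
    ultimately show "x \<in> (\<Union>k. (+) (int_vec k) ` (S \<inter> cbox 0 1))"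
      by (intro UN_I[of k] image_eqI[of _ _ "x - int_vec k"]) auto
  qed
  moreover have "negligible (\<Union>k. (+) (int_vec k) ` (S \<inter> cbox 0 1))"
    using neg by (intro negligible_countable_Union) (auto intro: negligible_translation)
  ultimately show ?thesis by (rule negligible_subset[rotated])
qed

lemma measure_lebesgue_cbox_cart:
  fixes a b :: "real ^ 'd::finite"
  assumes "\<And>i. b $ i - a $ i = c" "c \<ge> 0"
  shows "measure lebesgue (cbox a b) = c ^ CARD('d)"
proof -
  have "cbox a b \<noteq> {}" unfolding interval_ne_empty_cart using assms by (metis diff_ge_0_iff_ge)
  then have "measure lborel (cbox a b) = c ^ CARD('d)"
    by (subst content_cbox_cart) (auto simp: assms)
  then show ?thesis by simp
qed

text \<open>A set that is mapped into itself by doubling modulo 1 has density at most \<open>\<mu>(S \<inter> [0,1]\<^sup>d)\<close> in every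
  dyadic cube, because \<open>x \<mapsto> 2\<^sup>n x\<close> spreads such a cube over a whole period.\<close>

lemma doubling_zero_one:
  fixes S :: "(real ^ 'd::finite) set"
  assumes meas: "S \<in> sets lebesgue" and per: "int_periodic S"
    and doubling: "\<And>x. x \<in> S \<Longrightarrow> 2 *\<^sub>R x \<in> S"
  shows "negligible S \<or> negligible (- S)"
proof (rule ccontr)
  assume not01: "\<not> (negligible S \<or> negligible (- S))"
  define T where "T = S \<inter> cbox 0 1"
  define u where "u = measure lebesgue T"
  \<comment> \<open>The fraction of a cube that is sure to be lost: \<open>Q\<close> below is
    \<open>1 / 2^d\<close> of the cube, and inside \<open>Q\<close> the complement of
    \<open>S\<close> has density at least \<open>1 - u\<close>.\<close>
  define \<kappa> where "\<kappa> = (1 - u) / 2 ^ CARD('d)"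
  have cap_meas: "S \<inter> cbox a b \<in> lmeasurable" for a b
    using meas by (intro bounded_set_imp_lmeasurable) (auto intro: bounded_subset[OF bounded_cbox])
  have T: "T \<in> lmeasurable"
    unfolding T_def by (rule cap_meas)
  have box1: "measure lebesgue (cbox 0 1 :: (real ^ 'd) set) = 1"
    by (subst measure_lebesgue_cbox_cart[of _ _ 1]) auto
  have "u \<noteq> 0"
    using not01 negligible_int_periodic[OF per] negligible_iff_measure0[OF T] by (auto simp: u_def T_def)
  then have "u > 0" by (simp add: u_def zero_less_measure_iff)
  have "u < 1"
  proof -
    have "- S \<inter> cbox 0 1 = cbox 0 1 - T" by (auto simp: T_def)
    moreover have "cbox 0 1 - T \<in> lmeasurable" using T by (intro fmeasurable.Diff) auto
    moreover have "\<not> negligible (- S \<inter> cbox 0 1)"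
      using not01 negligible_int_periodic[OF int_periodic_uminus[OF per]] by blast
    ultimately have "measure lebesgue (cbox 0 1 - T) > 0"
      using negligible_iff_measure0[of "cbox 0 1 - T"] by (simp add: zero_less_measure_iff)
    also have "measure lebesgue (cbox 0 1 - T) = 1 - u"
      unfolding u_def using T by (subst measurable_measure_Diff) (auto simp: box1 T_def fmeasurableD)
    finally show ?thesis by simp
  qed
  then have \<kappa>: "0 < \<kappa>" "\<kappa> < 1"
    using \<open>u > 0\<close> by (auto simp: \<kappa>_def divide_less_eq intro: less_le_trans[of _ 1])
  have powers: "2 ^ n *\<^sub>R x \<in> S" if "x \<in> S" for n :: nat and x
    using that
  proof (induction n)
    case (Suc n)
    then show ?case using doubling[of "2 ^ n *\<^sub>R x"] by simp
  qed simp
  \<comment> \<open>The covering cubes used later are known only by their side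
    \<open>1 / 2 ^ n\<close>, not by their corners. Hence a cell \<open>Q\<close> of the grid of
    mesh \<open>1 / M\<close>, half the side, is found inside. Multiplication by \<open>M\<close>
    and a lattice shift take \<open>Q\<close> onto the unit cube and \<open>S \<inter> Q\<close>
    into \<open>T\<close>.\<close>
  have cube: "measure lebesgue (S \<inter> cbox a b) \<le> (1 - \<kappa>) * measure lebesgue (cbox a b)"
    if side: "\<And>i. b $ i - a $ i = 1 / 2 ^ n" for a b :: "real ^ 'd" and n
  proof -
    define M :: real where "M = 2 ^ Suc n"
    have M: "M > 0" by (simp add: M_def)
    have side: "b $ i - a $ i = 2 / M" for i using side by (simp add: M_def)
    define k :: "int ^ 'd" where "k = (\<chi> i. \<lceil>M * a $ i\<rceil>)"
    define Q where "Q = cbox ((1 / M) *\<^sub>R int_vec k) ((1 / M) *\<^sub>R (int_vec k + 1))"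
    have "Q \<subseteq> cbox a b"
    proof -
      have "a $ i \<le> real_of_int (k $ i) / M" "(real_of_int (k $ i) + 1) / M \<le> b $ i" for i
      proof -
        have "M * a $ i \<le> real_of_int (k $ i)" "real_of_int (k $ i) < M * a $ i + 1"
          by (simp_all add: k_def) linarith
        moreover have "M * b $ i = M * a $ i + 2" using side[of i] M by (simp add: field_simps)
        ultimately show "a $ i \<le> real_of_int (k $ i) / M" "(real_of_int (k $ i) + 1) / M \<le> b $ i"
          using M by (simp_all add: pos_le_divide_eq pos_divide_le_eq mult.commute)
      qed
      then show ?thesis
        unfolding Q_def by (intro subset_interval_cart(1)[THEN iffD2]) (auto simp: int_vec_def)
    qed
    have Q: "measure lebesgue Q = (1 / M) ^ CARD('d)"
      unfolding Q_def using M by (intro measure_lebesgue_cbox_cart) (auto simp: int_vec_def field_simps)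
    have ab: "measure lebesgue (cbox a b) = (2 / M) ^ CARD('d)"
      using M side by (intro measure_lebesgue_cbox_cart) auto
    have "S \<inter> Q \<subseteq> (\<lambda>y. (1 / M) *\<^sub>R y + (1 / M) *\<^sub>R int_vec k) ` T"
    proof
      fix x assume x: "x \<in> S \<inter> Q"
      define y where "y = M *\<^sub>R x - int_vec k"
      have "M *\<^sub>R x \<in> S" using powers[of x "Suc n"] x by (simp add: M_def)
      moreover have "y = M *\<^sub>R x + int_vec (- k)" by (simp add: y_def int_vec_uminus)
      ultimately have "y \<in> S" using per by (simp only: int_periodic_def)
      moreover have "y \<in> cbox 0 1"
        using x M by (auto simp: Q_def y_def mem_box_cart pos_divide_le_eq pos_le_divide_eq mult.commute
            diff_le_eq add.commute)
      moreover have "x = (1 / M) *\<^sub>R y + (1 / M) *\<^sub>R int_vec k"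
        using M by (simp add: y_def scaleR_diff_right)
      ultimately show "x \<in> (\<lambda>y. (1 / M) *\<^sub>R y + (1 / M) *\<^sub>R int_vec k) ` T"
        by (auto simp: T_def)
    qed
    moreover have "(\<lambda>y. (1 / M) *\<^sub>R y + (1 / M) *\<^sub>R int_vec k) ` T \<in> lmeasurable"
    proof (rule fmeasurableI)
      have "(\<lambda>y. (1 / M) *\<^sub>R y + (1 / M) *\<^sub>R int_vec k) ` T
          = (*\<^sub>R) M -` ((+) (int_vec k) ` T) \<inter> space lebesgue"
      proof -
        have "z = M *\<^sub>R x \<longleftrightarrow> x = (1 / M) *\<^sub>R z" for x z :: "real ^ 'd"
          using M by auto
        then have "x = (1 / M) *\<^sub>R y + (1 / M) *\<^sub>R int_vec k \<longleftrightarrow> M *\<^sub>R x = int_vec k + y" for x y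
          by (metis add.commute scaleR_add_right)
        then show ?thesis by (auto simp: image_iff)
      qed
      then show "(\<lambda>y. (1 / M) *\<^sub>R y + (1 / M) *\<^sub>R int_vec k) ` T \<in> sets lebesgue"
        using T by (simp only:) (intro measurable_sets[OF lebesgue_measurable_scaling] fmeasurableD measurable_translation)
      show "emeasure lebesgue ((\<lambda>y. (1 / M) *\<^sub>R y + (1 / M) *\<^sub>R int_vec k) ` T) < \<infinity>"
        using fmeasurableD2[OF T] by (simp add: emeasure_lebesgue_affine ennreal_mult_less_top less_top)
    qed
    ultimately have "measure lebesgue (S \<inter> Q) \<le> measure lebesgue ((\<lambda>y. (1 / M) *\<^sub>R y + (1 / M) *\<^sub>R int_vec k) ` T)"
      using meas by (intro measure_mono_fmeasurable) (auto simp: Q_def)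
    also have "\<dots> = u * (1 / M) ^ CARD('d)"
      using M by (simp add: measure_lebesgue_affine u_def)
    finally have SQ: "measure lebesgue (S \<inter> Q) \<le> u * (1 / M) ^ CARD('d)" .
    have "measure lebesgue (S \<inter> cbox a b) \<le> measure lebesgue ((cbox a b - Q) \<union> (S \<inter> Q))"
      using meas \<open>Q \<subseteq> cbox a b\<close>
      by (intro measure_mono_fmeasurable fmeasurable.Un fmeasurable.Diff) (auto simp: Q_def cap_meas)
    also have "\<dots> \<le> measure lebesgue (cbox a b - Q) + measure lebesgue (S \<inter> Q)"
      using meas by (intro measure_Un_le) (auto simp: Q_def)
    also have "measure lebesgue (cbox a b - Q) = (2 / M) ^ CARD('d) - (1 / M) ^ CARD('d)"
      unfolding ab[symmetric] Q[symmetric] using \<open>Q \<subseteq> cbox a b\<close>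
      by (intro measurable_measure_Diff) (auto simp: Q_def)
    also have "\<dots> + measure lebesgue (S \<inter> Q) \<le> (2 / M) ^ CARD('d) - (1 - u) * (1 / M) ^ CARD('d)"
      using SQ by (simp add: algebra_simps)
    also have "\<dots> = (1 - \<kappa>) * (2 / M) ^ CARD('d)"
    proof -
      have half: "(1 / M) ^ CARD('d) = (2 / M) ^ CARD('d) / 2 ^ CARD('d)" by (simp add: power_divide)
      show ?thesis unfolding \<kappa>_def half by (simp only: left_diff_distrib times_divide_eq_left times_divide_eq_right mult_1_left)
    qed
    finally show ?thesis by (simp only: ab)
  qed
  \<comment> \<open>A cover exceeding \<open>T\<close> by at most \<open>\<kappa> * u / 2\<close> is
    good enough for a contradiction, since
    \<open>(1 - \<kappa>) * (1 + \<kappa> / 2) < 1\<close>.\<close>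
  have e_pos: "\<kappa> * u / 2 > 0" using \<kappa> \<open>u > 0\<close> by simp
  obtain \<D> where D: "countable \<D>" "\<And>K. K \<in> \<D> \<Longrightarrow> K \<subseteq> cbox 0 1 \<and> K \<noteq> {} \<and> (\<exists>c d. K = cbox c d)"
    "pairwise (\<lambda>A B. interior A \<inter> interior B = {}) \<D>"
    and D_side: "\<And>c d. cbox c d \<in> \<D> \<Longrightarrow> \<exists>n. \<forall>i \<in> Basis. d \<bullet> i - c \<bullet> i = ((1 :: real ^ 'd) \<bullet> i - 0 \<bullet> i) / 2 ^ n"
    and D_cover: "T \<subseteq> \<Union>\<D>" "\<Union>\<D> \<in> lmeasurable" "measure lebesgue (\<Union>\<D>) \<le> u + \<kappa> * u / 2"
  proof (rule measurable_outer_intervals_bounded[OF T _ e_pos])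
    show "T \<subseteq> cbox 0 1" by (simp add: T_def)
  qed (rule that, auto simp only: u_def)
  have D_meas: "K \<in> lmeasurable" if "K \<in> \<D>" for K using D(2)[OF that] by auto
  have D_cube: "measure lebesgue (S \<inter> K) \<le> (1 - \<kappa>) * measure lebesgue K" if K: "K \<in> \<D>" for K
  proof -
    obtain c d where cd: "K = cbox c d" using D(2)[OF K] by blast
    obtain n where n: "\<forall>i \<in> Basis. d \<bullet> i - c \<bullet> i = ((1 :: real ^ 'd) \<bullet> i - 0 \<bullet> i) / 2 ^ n"
      using D_side K cd by blast
    have "d $ i - c $ i = 1 / 2 ^ n" for i
      using n[rule_format, of "axis i 1"] by (simp add: inner_axis)
    then show ?thesis unfolding cd by (rule cube)
  qed
  have "measure lebesgue (\<Union>K\<in>\<D>. S \<inter> K) \<le> (1 - \<kappa>) * measure lebesgue (\<Union>\<D>)"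
  proof (rule measure_UN_bound[OF D(1)])
    show "S \<inter> K \<in> lmeasurable" if "K \<in> \<D>" for K
      using meas D_meas[OF that] by (simp add: fmeasurable_Int_fmeasurable Int_commute)
    fix F assume F: "F \<subseteq> \<D>" "finite F"
    have "measure lebesgue (\<Union>K\<in>F. S \<inter> K) \<le> (\<Sum>K\<in>F. measure lebesgue (S \<inter> K))"
      using F D_meas meas by (intro measure_UNION_le) auto
    also have "\<dots> \<le> (\<Sum>K\<in>F. (1 - \<kappa>) * measure lebesgue K)"
      using F D_cube by (intro sum_mono) auto
    also have "\<dots> = (1 - \<kappa>) * measure lebesgue (\<Union>F)"
    proof -
      have "negligible (A \<inter> B)" if AB: "A \<in> F" "B \<in> F" "A \<noteq> B" for A B
      proof -
        have "interior (A \<inter> B) = {}" using D(3) AB F by (auto simp: pairwise_def)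
        moreover have "convex (A \<inter> B)"
          using D(2) AB F by (metis convex_Int convex_box(1) subsetD)
        ultimately show ?thesis using negligible_convex_interior by blast
      qed
      then have "measure lebesgue (\<Union>F) = (\<Sum>K\<in>F. measure lebesgue K)"
        using F D_meas by (intro measure_negligible_finite_Union) (auto simp: pairwise_def)
      then show ?thesis by (simp add: sum_distrib_left)
    qed
    also have "\<dots> \<le> (1 - \<kappa>) * measure lebesgue (\<Union>\<D>)"
      using \<kappa> F D_meas D_cover(2)
      by (intro mult_left_mono measure_mono_fmeasurable) (auto intro!: sets.finite_Union)
    finally show "measure lebesgue (\<Union>K\<in>F. S \<inter> K) \<le> (1 - \<kappa>) * measure lebesgue (\<Union>\<D>)" .
  qed
  moreover have "(\<Union>K\<in>\<D>. S \<inter> K) = T" using D(2) D_cover(1) by (auto simp: T_def)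
  ultimately have "u \<le> (1 - \<kappa>) * measure lebesgue (\<Union>\<D>)" by (simp add: u_def)
  also have "\<dots> \<le> (1 - \<kappa>) * (u + \<kappa> * u / 2)"
    using \<kappa> D_cover(3) by (intro mult_left_mono) auto
  also have "\<dots> = u - \<kappa> * u / 2 - \<kappa> * \<kappa> * u / 2" by (simp add: field_simps)
  also have "\<dots> < u"
    using e_pos mult_pos_pos[OF \<kappa>(1) e_pos] by (simp only: times_divide_eq_right mult.assoc)
  finally show False by simp
qed

section \<open>Overlap estimates\<close>

definition cube :: "real ^ 'd \<Rightarrow> real \<Rightarrow> (real ^ 'd) set" where
  "cube c \<rho> = {x. \<forall>i. \<bar>x $ i - c $ i\<bar> < \<rho>}"

lemma cube_eq_box: "cube c \<rho> = box (\<chi> i. c $ i - \<rho>) (\<chi> i. c $ i + \<rho>)"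
  by (simp add: cube_def set_eq_iff mem_box_cart abs_diff_less_iff)

lemma cube_lmeasurable [simp]: "cube c \<rho> \<in> lmeasurable"
  by (simp add: cube_eq_box)

lemma measure_cube:
  fixes c :: "real ^ 'd::finite"
  assumes "\<rho> \<ge> 0"
  shows "measure lebesgue (cube c \<rho>) = (2 * \<rho>) ^ CARD('d)"
proof -
  have "cbox (\<chi> i. c $ i - \<rho>) (\<chi> i. c $ i + \<rho>) \<noteq> {}"
    using assms by (auto simp: interval_ne_empty_cart)
  then have "measure lborel (cbox (\<chi> i. c $ i - \<rho>) (\<chi> i. c $ i + \<rho>)) = (2 * \<rho>) ^ CARD('d)"
    by (subst content_cbox_cart) simp_all
  then show ?thesis by (simp add: cube_eq_box measure_lborel_box_eq measure_lborel_cbox_eq)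
qed

definition rational_point :: "nat \<Rightarrow> int ^ 'd \<Rightarrow> real ^ 'd" where
  "rational_point q p = (\<chi> i. real_of_int (p $ i) / real q)"

text \<open>Independence up to the factor \<open>3 ^ d\<close>, as
  \<open>12 * s * t = 3 * (2 * s) * (2 * t)\<close>. Each overlap has at most the volume of a cube
  of side \<open>m\<close>, and the overlapping pairs, counted coordinate by coordinate, number at
  most \<open>(3 * K) ^ d\<close>. That count fails for \<open>K\<close> below the gcd, where only
  coinciding points could overlap; primitivity excludes these since \<open>q\<close> and
  \<open>r\<close> differ.\<close>

lemma overlap_le:
  assumes qr: "q > 0" "r > 0" "q \<noteq> r" and nonneg: "s \<ge> 0" "t \<ge> 0"
  shows "(\<Sum>p\<in>primitive q. \<Sum>p'\<in>primitive r.
      measure lebesgue (cube (rational_point q p :: real ^ 'd::finite) (s / real q) \<inter>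
        cube (rational_point r p') (t / real r))) \<le> (12 * s * t) ^ CARD('d)"
proof -
  \<comment> \<open>The bound \<open>s / q + t / r\<close> for the distance of the centres of
    overlapping cubes, multiplied by \<open>q * r\<close>.\<close>
  define K where "K = s * real r + t * real q"
  define m where "m = min (2 * (s / real q)) (2 * (t / real r))"
  define P where "P = {(a, b). a \<in> {0..<int q} \<and> b \<in> {0..<int r} \<and>
      \<bar>real_of_int (a * int r - b * int q)\<bar> \<le> K}"
  define close :: "int ^ 'd \<Rightarrow> int ^ 'd \<Rightarrow> bool"
    where "close p p' \<longleftrightarrow> (\<forall>i. (p $ i, p' $ i) \<in> P)" for p p'
  define I where "I = {(p, p') \<in> primitive q \<times> primitive r. close p p'}"
  define cap where "cap p p' = cube (rational_point q p :: real ^ 'd) (s / real q) \<inter>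
        cube (rational_point r p') (t / real r)" for p p'
  have m: "m \<ge> 0" and K: "K \<ge> 0" using nonneg by (auto simp: m_def K_def)
  have cap_meas: "cap p p' \<in> sets lebesgue" for p p'
    unfolding cap_def by (intro sets.Int fmeasurableD cube_lmeasurable)
  have "measure lebesgue (cap p p') \<le> m ^ CARD('d)" for p p'
  proof -
    have "measure lebesgue (cap p p') \<le> (2 * (s / real q)) ^ CARD('d)"
      using measure_mono_fmeasurable[of "cap p p'" "cube (rational_point q p) (s / real q)" lebesgue]
        nonneg cap_meas[of p p'] by (auto simp: cap_def measure_cube)
    moreover have "measure lebesgue (cap p p') \<le> (2 * (t / real r)) ^ CARD('d)"
      using measure_mono_fmeasurable[of "cap p p'" "cube (rational_point r p') (t / real r)" lebesgue]
        nonneg cap_meas[of p p'] by (auto simp: cap_def measure_cube)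
    ultimately show ?thesis by (simp add: m_def min_def)
  qed
  moreover have "close p p'" if prim: "p \<in> primitive q" "p' \<in> primitive r" and cap: "cap p p' \<noteq> {}" for p p'
  proof -
    obtain x where x: "x \<in> cap p p'" using cap by blast
    show ?thesis
      unfolding close_def
    proof
      fix i
      have "\<bar>x $ i - real_of_int (p $ i) / real q\<bar> < s / real q"
        and "\<bar>x $ i - real_of_int (p' $ i) / real r\<bar> < t / real r"
        using x by (auto simp: cap_def cube_def rational_point_def)
      then have "\<bar>real_of_int (p $ i) / real q - real_of_int (p' $ i) / real r\<bar> \<le> s / real q + t / real r"
        by linarith
      then have "\<bar>real_of_int (p $ i) / real q - real_of_int (p' $ i) / real r\<bar> * (real q * real r)
          \<le> (s / real q + t / real r) * (real q * real r)"
        by (rule mult_right_mono) simp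
      also have "\<dots> = K" using qr by (simp add: K_def field_simps)
      also have "\<bar>real_of_int (p $ i) / real q - real_of_int (p' $ i) / real r\<bar> * (real q * real r)
          = \<bar>(real_of_int (p $ i) / real q - real_of_int (p' $ i) / real r) * (real q * real r)\<bar>"
        by (simp add: abs_mult)
      also have "(real_of_int (p $ i) / real q - real_of_int (p' $ i) / real r) * (real q * real r)
          = real_of_int (p $ i * int r - p' $ i * int q)"
        using qr by (simp add: field_simps)
      finally show "(p $ i, p' $ i) \<in> P"
        using prim by (auto simp: P_def primitive_def)
    qed
  qed
  ultimately have "(\<Sum>p\<in>primitive q. \<Sum>p'\<in>primitive r. measure lebesgue (cap p p'))
      \<le> (\<Sum>p\<in>primitive q. \<Sum>p'\<in>primitive r. if close p p' then m ^ CARD('d) else 0)"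
    by (intro sum_mono) (metis measure_empty order_refl)
  also have "\<dots> = (\<Sum>z\<in>primitive q \<times> primitive r. if z \<in> I then m ^ CARD('d) else 0)"
    by (subst sum.cartesian_product) (auto simp: I_def intro!: sum.cong)
  also have "\<dots> = real (card I) * m ^ CARD('d)"
    by (subst sum.inter_filter[symmetric])
       (auto simp: finite_primitive I_def intro!: arg_cong[where f = card])
  also have "\<dots> \<le> (3 * K * m) ^ CARD('d)"
  proof (cases "real (gcd q r) \<le> K")
    case True
    have "finite P"
      by (rule finite_subset[of _ "{0..<int q} \<times> {0..<int r}"]) (auto simp: P_def)
    have "inj_on (\<lambda>(p, p'). \<chi> i. (p $ i, p' $ i)) I"
      by (auto simp: inj_on_def vec_eq_iff)
    moreover have "(\<lambda>(p, p'). \<chi> i. (p $ i, p' $ i)) ` I \<subseteq> {v :: (int \<times> int) ^ 'd. \<forall>i. v $ i \<in> P}"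
      by (auto simp: I_def close_def)
    moreover have "finite {v :: (int \<times> int) ^ 'd. \<forall>i. v $ i \<in> P}"
      by (rule finite_vec_Collect) (rule \<open>finite P\<close>)
    ultimately have "card I \<le> card {v :: (int \<times> int) ^ 'd. \<forall>i. v $ i \<in> P}"
      by (rule card_inj_on_le)
    also have "\<dots> = card P ^ CARD('d)" by (simp add: card_vec_Collect)
    finally have "real (card I) \<le> real (card P) ^ CARD('d)"
      by (metis of_nat_le_iff of_nat_power)
    also have "\<dots> \<le> (3 * K) ^ CARD('d)"
      using card_close_fractions_le[OF qr(1,2) True] by (intro power_mono) (auto simp: P_def)
    finally have "real (card I) * m ^ CARD('d) \<le> (3 * K) ^ CARD('d) * m ^ CARD('d)"
      using m by (intro mult_right_mono) auto
    then show ?thesis by (simp add: power_mult_distrib)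
  next
    case False
    have "I = {}"
    proof (rule ccontr)
      assume "I \<noteq> {}"
      then obtain p p' where p: "p \<in> primitive q" "p' \<in> primitive r" and c: "close p p'"
        by (auto simp: I_def)
      have "p $ i * int r = p' $ i * int q" for i
      proof -
        have "\<bar>real_of_int (p $ i * int r - p' $ i * int q)\<bar> < real (gcd q r)"
        proof -
          have "(p $ i, p' $ i) \<in> P" using c by (simp add: close_def)
          then have "\<bar>real_of_int (p $ i * int r - p' $ i * int q)\<bar> \<le> K" by (simp add: P_def)
          then show ?thesis using False by linarith
        qed
        then have "\<bar>p $ i * int r - p' $ i * int q\<bar> < int (gcd q r)"
          by linarith
        moreover have "int (gcd q r) dvd p $ i * int r - p' $ i * int q"
          by (intro dvd_diff dvd_mult) auto
        ultimately show ?thesis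
          using dvd_imp_le_int[of "p $ i * int r - p' $ i * int q" "int (gcd q r)"] by linarith
      qed
      then show False using primitive_denominator_unique[OF p qr(1,2)] qr(3) by blast
    qed
    then show ?thesis using m K by simp
  qed
  also have "\<dots> \<le> (12 * s * t) ^ CARD('d)"
  proof (rule power_mono)
    \<comment> \<open>In each term \<open>m\<close> is replaced by that argument of the minimum
      whose denominator cancels.\<close>
    have "K * m = s * real r * m + t * real q * m" by (simp add: K_def algebra_simps)
    also have "\<dots> \<le> s * real r * (2 * (t / real r)) + t * real q * (2 * (s / real q))"
      using nonneg by (intro add_mono mult_left_mono) (auto simp: m_def)
    also have "\<dots> = 4 * (s * t)" using qr by simp
    finally show "3 * K * m \<le> 12 * s * t" by simp
  qed (use m K in auto)
  finally show ?thesis by (simp only: cap_def)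
qed

text \<open>Distinct numerators give centres at least \<open>1 / q\<close> apart in some coordinate,
  so for \<open>s <= 1 / 2\<close> the cubes are disjoint and only the diagonal counts.\<close>

lemma overlap_same_denominator_le:
  assumes q: "q > 0" and s: "0 \<le> s" "s \<le> 1 / 2"
  shows "(\<Sum>p\<in>primitive q. \<Sum>p'\<in>primitive q.
      measure lebesgue (cube (rational_point q p :: real ^ 'd::finite) (s / real q) \<inter>
        cube (rational_point q p') (s / real q))) \<le> (2 * s) ^ CARD('d)"
proof -
  define cap where "cap p p' = cube (rational_point q p :: real ^ 'd) (s / real q) \<inter>
        cube (rational_point q p') (s / real q)" for p p'
  have cap_empty: "cap p p' = {}" if ne: "p \<noteq> p'" for p p'
  proof (rule ccontr)
    assume "cap p p' \<noteq> {}"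
    then obtain x where x: "x \<in> cap p p'" by blast
    obtain i where i: "p $ i \<noteq> p' $ i" using ne unfolding vec_eq_iff by blast
    have "\<bar>x $ i - real_of_int (p $ i) / real q\<bar> < s / real q"
      and "\<bar>x $ i - real_of_int (p' $ i) / real q\<bar> < s / real q"
      using x by (auto simp: cap_def cube_def rational_point_def)
    then have "\<bar>real_of_int (p $ i) / real q - real_of_int (p' $ i) / real q\<bar> < 2 * s / real q"
      by linarith
    also have "real_of_int (p $ i) / real q - real_of_int (p' $ i) / real q
        = real_of_int (p $ i - p' $ i) / real q" by (simp add: diff_divide_distrib)
    finally have "\<bar>real_of_int (p $ i - p' $ i)\<bar> < 2 * s"
      using q by (simp add: divide_less_cancel)
    then show False using i s by linarith
  qed
  have "measure lebesgue (cap p p') = (if p = p' then (2 * (s / real q)) ^ CARD('d) else 0)" for p p'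
  proof (cases "p = p'")
    case True
    then have "cap p p' = cube (rational_point q p) (s / real q)" by (simp add: cap_def)
    then show ?thesis using s True by (simp add: measure_cube)
  qed (simp add: cap_empty)
  then have "(\<Sum>p\<in>primitive q. \<Sum>p'\<in>primitive q. measure lebesgue (cap p p'))
      = (\<Sum>p\<in>(primitive q :: (int ^ 'd) set). \<Sum>p'\<in>primitive q. if p = p' then (2 * (s / real q)) ^ CARD('d) else 0)"
    by simp
  also have "\<dots> = real (card (primitive q :: (int ^ 'd) set)) * (2 * (s / real q)) ^ CARD('d)"
    by (simp add: finite_primitive)
  also have "\<dots> \<le> real q ^ CARD('d) * (2 * (s / real q)) ^ CARD('d)"
  proof (rule mult_right_mono)
    have "card (primitive q :: (int ^ 'd) set) \<le> card {p :: int ^ 'd. \<forall>i. p $ i \<in> {0..<int q}}"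
      by (rule card_mono[OF finite_vec_Collect]) (auto simp: primitive_def)
    also have "\<dots> = q ^ CARD('d)" unfolding card_vec_Collect by simp
    finally show "real (card (primitive q :: (int ^ 'd) set)) \<le> real q ^ CARD('d)"
      by (metis of_nat_le_iff of_nat_power)
  qed (use s in simp)
  also have "\<dots> = (2 * s) ^ CARD('d)" using q by (subst power_mult_distrib[symmetric]) simp
  finally show ?thesis by (simp only: cap_def)
qed

text \<open>Only numerators in \<open>[0, q)\<close> occur, so this set is not periodic. It serves
  to produce positive measure; periodicity comes back with the set \<open>U\<close> of
  \<open>gallagher\<close>.\<close>

definition near_rational :: "nat \<Rightarrow> real \<Rightarrow> (real ^ 'd::finite) set" where
  "near_rational q s = (\<Union>p\<in>primitive q. cube (rational_point q p) (s / real q))"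

lemma near_rational_lmeasurable [simp]: "near_rational q s \<in> lmeasurable"
  unfolding near_rational_def by (intro fmeasurable.finite_UN finite_primitive) auto

text \<open>The bound does not depend on \<open>Q\<close>, which is what the passage to the limsup
  requires. Taking single cubes as the events in \<open>chung_erdos\<close> avoids measuring unions.
  The 16 is \<open>4 ^ 2\<close>, from the proportion 1/4 of primitive points, and
  \<open>1 + 3 ^ d\<close> comes from equal and unequal denominators; as the sum is at least 1, it
  is absorbed in its square.\<close>

lemma measure_Union_near_rational_ge:
  assumes d: "CARD('d::finite) \<ge> 2" and Q: "finite Q" "0 \<notin> Q"
    and \<psi>: "\<And>q. 0 \<le> \<psi> q" "\<And>q. \<psi> q \<le> 1 / 2"
    and ge1: "1 \<le> (\<Sum>q\<in>Q. (2 * \<psi> q) ^ CARD('d))"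
  shows "1 / (16 * (1 + 3 ^ CARD('d)))
      \<le> measure lebesgue (\<Union>q\<in>Q. near_rational q (\<psi> q) :: (real ^ 'd) set)"
proof -
  define w where "w q = (2 * \<psi> q) ^ CARD('d)" for q
  define A where "A = (\<lambda>(q, p). cube (rational_point q p :: real ^ 'd) (\<psi> q / real q))"
  define K where "K = (SIGMA q:Q. (primitive q :: (int ^ 'd) set))"
  define S where "S = (\<Sum>q\<in>Q. w q)"
  define S1 where "S1 = (\<Sum>k\<in>K. measure lebesgue (A k))"
  define S2 where "S2 = (\<Sum>k\<in>K. \<Sum>l\<in>K. measure lebesgue (A k \<inter> A l))"
  define \<mu> where "\<mu> = measure lebesgue (\<Union>q\<in>Q. near_rational q (\<psi> q) :: (real ^ 'd) set)"
  have Q_pos: "q > 0" if "q \<in> Q" for q using that Q(2) by (metis neq0_conv)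
  have w: "0 \<le> w q" for q using \<psi> by (simp add: w_def)
  have S: "S \<ge> 1" using ge1 by (simp add: S_def w_def)
  have "\<mu> = measure lebesgue (\<Union>k\<in>K. A k)"
    unfolding \<mu>_def K_def A_def near_rational_def
    by (rule arg_cong[where f = "measure lebesgue"]) auto
  then have CE: "S1\<^sup>2 \<le> \<mu> * S2"
    unfolding S1_def S2_def using Q
    by (simp only:) (rule chung_erdos, auto simp: K_def A_def finite_primitive)
  have sum_K: "(\<Sum>k\<in>K. f k) = (\<Sum>q\<in>Q. \<Sum>p\<in>primitive q. f (q, p))" for f :: "_ \<Rightarrow> real"
    unfolding K_def using Q by (subst sum.Sigma) (auto simp: finite_primitive)
  have "S / 4 \<le> S1"
  proof -
    have "S1 = (\<Sum>q\<in>Q. \<Sum>p\<in>primitive q. measure lebesgue (A (q, p)))"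
      unfolding S1_def by (rule sum_K)
    also have "\<dots> = (\<Sum>q\<in>Q. real (card (primitive q :: (int ^ 'd) set)) * (2 * (\<psi> q / real q)) ^ CARD('d))"
      using \<psi> by (simp add: A_def measure_cube)
    also have "\<dots> \<ge> (\<Sum>q\<in>Q. real q ^ CARD('d) / 4 * (2 * (\<psi> q / real q)) ^ CARD('d))"
      using \<psi> d Q_pos by (intro sum_mono mult_right_mono card_primitive_ge) auto
    also have "(\<Sum>q\<in>Q. real q ^ CARD('d) / 4 * (2 * (\<psi> q / real q)) ^ CARD('d)) = S / 4"
      unfolding S_def w_def sum_divide_distrib using Q_pos
      by (intro sum.cong) (auto simp: power_mult_distrib power_divide)
    finally show ?thesis .
  qed
  then have "(S / 4)\<^sup>2 \<le> S1\<^sup>2" using S by (intro power_mono) auto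
  have S2_eq: "S2 = (\<Sum>q\<in>Q. \<Sum>r\<in>Q. \<Sum>p\<in>(primitive q :: (int ^ 'd) set). \<Sum>p'\<in>primitive r.
      measure lebesgue (A (q, p) \<inter> A (r, p')))"
  proof -
    have "S2 = (\<Sum>q\<in>Q. \<Sum>p\<in>(primitive q :: (int ^ 'd) set). \<Sum>r\<in>Q. \<Sum>p'\<in>(primitive r :: (int ^ 'd) set).
      measure lebesgue (A (q, p) \<inter> A (r, p')))"
      unfolding S2_def sum_K ..
    also have "\<dots> = (\<Sum>q\<in>Q. \<Sum>r\<in>Q. \<Sum>p\<in>(primitive q :: (int ^ 'd) set). \<Sum>p'\<in>primitive r.
      measure lebesgue (A (q, p) \<inter> A (r, p')))"
      by (intro sum.cong[OF refl] sum.swap)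
    finally show ?thesis .
  qed
  also have "\<dots> \<le> (\<Sum>q\<in>Q. \<Sum>r\<in>Q. (if q = r then w q else 0) + 3 ^ CARD('d) * (w q * w r))"
  proof (intro sum_mono)
    fix q r assume qr: "q \<in> Q" "r \<in> Q"
    show "(\<Sum>p\<in>(primitive q :: (int ^ 'd) set). \<Sum>p'\<in>primitive r.
        measure lebesgue (A (q, p) \<inter> A (r, p'))) \<le> (if q = r then w q else 0) + 3 ^ CARD('d) * (w q * w r)"
    proof (cases "q = r")
      case True
      have "0 \<le> 3 ^ CARD('d) * (w q * w r)" using w by simp
      moreover have "(\<Sum>p\<in>(primitive q :: (int ^ 'd) set). \<Sum>p'\<in>primitive r.
        measure lebesgue (A (q, p) \<inter> A (r, p'))) \<le> w q"
        using overlap_same_denominator_le[of q "\<psi> q", where 'd = 'd] \<psi> Q_pos[OF qr(1)]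
        by (simp add: A_def w_def flip: True)
      ultimately show ?thesis unfolding if_P[OF True] by linarith
    next
      case False
      have "(\<Sum>p\<in>(primitive q :: (int ^ 'd) set). \<Sum>p'\<in>primitive r.
        measure lebesgue (A (q, p) \<inter> A (r, p'))) \<le> (12 * \<psi> q * \<psi> r) ^ CARD('d)"
        using overlap_le[of q r "\<psi> q" "\<psi> r", where 'd = 'd] \<psi> Q_pos qr False
        by (simp add: A_def)
      also have "\<dots> = (3 * ((2 * \<psi> q) * (2 * \<psi> r))) ^ CARD('d)" by (simp add: mult_ac)
      also have "\<dots> = 3 ^ CARD('d) * (w q * w r)"
        unfolding w_def by (simp only: power_mult_distrib)
      finally show ?thesis using False by simp
    qed
  qed
  also have "\<dots> = S + 3 ^ CARD('d) * S\<^sup>2"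
  proof -
    have "(\<Sum>q\<in>Q. \<Sum>r\<in>Q. if q = r then w q else 0) = S"
      using Q by (simp add: S_def)
    moreover have "(\<Sum>q\<in>Q. \<Sum>r\<in>Q. w q * w r) = S\<^sup>2"
      by (simp only: S_def power2_eq_square sum_product)
    ultimately show ?thesis by (simp only: sum.distrib flip: sum_distrib_left)
  qed
  also have "\<dots> \<le> (1 + 3 ^ CARD('d)) * S\<^sup>2"
    using S by (simp add: distrib_right power2_eq_square mult_left_le_imp_le)
  finally have "S2 \<le> (1 + 3 ^ CARD('d)) * S\<^sup>2" .
  have "(S / 4)\<^sup>2 \<le> \<mu> * ((1 + 3 ^ CARD('d)) * S\<^sup>2)"
  proof -
    have "(S / 4)\<^sup>2 \<le> \<mu> * S2" using CE \<open>(S / 4)\<^sup>2 \<le> S1\<^sup>2\<close> by linarith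
    also have "\<dots> \<le> \<mu> * ((1 + 3 ^ CARD('d)) * S\<^sup>2)"
      using \<open>S2 \<le> _\<close> by (intro mult_left_mono) (auto simp: \<mu>_def)
    finally show ?thesis .
  qed
  then have "S\<^sup>2 * (1 / 16) \<le> S\<^sup>2 * (\<mu> * (1 + 3 ^ CARD('d)))"
    by (simp add: power_divide algebra_simps)
  then have "1 / 16 \<le> \<mu> * (1 + 3 ^ CARD('d))"
    using S by (subst (asm) mult_le_cancel_left_pos) auto
  moreover have "0 < 1 + (3 :: real) ^ CARD('d)" by (intro add_pos_pos zero_less_power) auto
  ultimately have "1 / 16 / (1 + 3 ^ CARD('d)) \<le> \<mu>"
    by (simp only: pos_divide_le_eq)
  then show ?thesis by (simp only: \<mu>_def divide_divide_eq_left)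
qed

section \<open>A Khintchine theorem without monotonicity\<close>

lemma near_rational_imp_nid_less:
  fixes x :: "real ^ 'd::finite"
  assumes x: "x \<in> near_rational q s" and q: "q > 0"
  shows "nid (real q *\<^sub>R x) < s"
proof -
  obtain p where p: "x \<in> cube (rational_point q p) (s / real q)"
    using x by (auto simp: near_rational_def)
  have "\<bar>(real q *\<^sub>R x + int_vec (- p)) $ i\<bar> < s" for i
  proof -
    have "\<bar>x $ i - real_of_int (p $ i) / real q\<bar> * real q < s"
      using p q by (simp add: cube_def rational_point_def pos_less_divide_eq)
    also have "\<bar>x $ i - real_of_int (p $ i) / real q\<bar> * real q
        = \<bar>(x $ i - real_of_int (p $ i) / real q) * real q\<bar>"
      by (simp add: abs_mult)
    also have "(x $ i - real_of_int (p $ i) / real q) * real q = (real q *\<^sub>R x + int_vec (- p)) $ i"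
      using q by (simp add: int_vec_def field_simps)
    finally show ?thesis .
  qed
  then show ?thesis unfolding nid_less_iff infnorm_less_iff by blast
qed

lemma near_rational_subset_cbox:
  assumes q: "q > 0" and s: "s \<le> 1 / 2"
  shows "near_rational q s \<subseteq> cbox (vec (- 1)) (vec 2 :: real ^ 'd::finite)"
proof
  fix x :: "real ^ 'd" assume "x \<in> near_rational q s"
  then obtain p where p: "p \<in> primitive q" "x \<in> cube (rational_point q p) (s / real q)"
    by (auto simp: near_rational_def)
  have "- 1 \<le> x $ i \<and> x $ i \<le> 2" for i
  proof -
    have "s / real q \<le> (1 / 2) / 1" using q s by (intro frac_le) auto
    moreover have "\<bar>x $ i - real_of_int (p $ i) / real q\<bar> < s / real q"
      using p by (simp add: cube_def rational_point_def)
    moreover have "0 \<le> p $ i" "p $ i < int q" using p by (auto simp: primitive_def)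
    then have "0 \<le> real_of_int (p $ i) / real q" "real_of_int (p $ i) / real q \<le> 1"
      using q by auto
    ultimately show ?thesis by linarith
  qed
  then show "x \<in> cbox (vec (- 1)) (vec 2)" by (simp add: mem_box_cart)
qed

text \<open>Every tail of the series contains a finite block with sum at least 1, so every tail
  union has measure at least \<open>\<kappa>\<close>. Continuity from above carries this over to the
  intersection; a common bounding box provides the finite measure that it requires.\<close>

lemma not_negligible_limsup:
  fixes \<psi> :: "nat \<Rightarrow> real"
  assumes d: "CARD('d::finite) \<ge> 2" and \<psi>: "\<And>q. 0 \<le> \<psi> q" "\<And>q. \<psi> q \<le> 1 / 2"
    and div: "\<not> summable (\<lambda>q. \<psi> q ^ CARD('d))"
  shows "\<not> negligible {x :: real ^ 'd. \<exists>\<^sub>F q in sequentially. nid (real q *\<^sub>R x) < \<psi> q}"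
    (is "\<not> negligible ?L")
proof
  assume neg: "negligible ?L"
  define \<kappa> :: real where "\<kappa> = 1 / (16 * (1 + 3 ^ CARD('d)))"
  \<comment> \<open>The index starts after \<open>n\<close>, which keeps the denominator 0 out of
    every block.\<close>
  define B where "B n = (\<Union>q\<in>{n<..}. near_rational q (\<psi> q) :: (real ^ 'd) set)" for n
  have B_box: "B n \<subseteq> cbox (vec (- 1)) (vec 2)" for n
    unfolding B_def by (intro UN_least near_rational_subset_cbox[OF _ \<psi>(2)]) auto
  have B_meas: "B n \<in> lmeasurable" for n
  proof (rule bounded_set_imp_lmeasurable)
    show "bounded (B n)" by (rule bounded_subset[OF bounded_cbox B_box])
    show "B n \<in> sets lebesgue" unfolding B_def by (intro sets.countable_UN') (auto simp: fmeasurableD)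
  qed
  have B_ge: "\<kappa> \<le> measure lebesgue (B n)" for n
  proof -
    have "\<exists>m. 1 \<le> (\<Sum>q\<in>{n<..m}. (2 * \<psi> q) ^ CARD('d))"
    proof (rule ccontr)
      assume "\<not> ?thesis"
      then have small: "(\<Sum>q\<in>{n<..m}. (2 * \<psi> q) ^ CARD('d)) \<le> 1" for m
        by (meson linear)
      have "(\<Sum>q\<le>m. (2 * \<psi> q) ^ CARD('d)) \<le> (\<Sum>q\<le>n. (2 * \<psi> q) ^ CARD('d)) + 1" for m
      proof -
        have "(\<Sum>q\<le>m. (2 * \<psi> q) ^ CARD('d)) \<le> (\<Sum>q\<in>{..n} \<union> {n<..m}. (2 * \<psi> q) ^ CARD('d))"
          using \<psi> by (intro sum_mono2) auto
        also have "\<dots> = (\<Sum>q\<le>n. (2 * \<psi> q) ^ CARD('d)) + (\<Sum>q\<in>{n<..m}. (2 * \<psi> q) ^ CARD('d))"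
          by (rule sum.union_disjoint) auto
        finally show ?thesis using small[of m] by linarith
      qed
      then have "summable (\<lambda>q. (2 * \<psi> q) ^ CARD('d))"
        using \<psi> by (intro bounded_imp_summable) auto
      then show False using div by (simp add: power_mult_distrib)
    qed
    then obtain m where m: "1 \<le> (\<Sum>q\<in>{n<..m}. (2 * \<psi> q) ^ CARD('d))" ..
    have "\<kappa> \<le> measure lebesgue (\<Union>q\<in>{n<..m}. near_rational q (\<psi> q) :: (real ^ 'd) set)"
      unfolding \<kappa>_def using d \<psi> m by (intro measure_Union_near_rational_ge) auto
    also have "\<dots> \<le> measure lebesgue (B n)"
      using B_meas[of n]
      by (intro measure_mono_fmeasurable) (auto simp: B_def fmeasurableD intro!: sets.finite_UN)
    finally show ?thesis .
  qed
  have "(\<lambda>n. measure lebesgue (B n)) \<longlonglongrightarrow> measure lebesgue (\<Inter>n. B n)"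
  proof (rule Lim_measure_decseq)
    show "range B \<subseteq> sets lebesgue" using fmeasurableD[OF B_meas] by blast
    have "B n \<subseteq> B m" if "m \<le> n" for m n unfolding B_def using that by (intro UN_mono) auto
    then show "decseq B" by (simp add: decseq_def)
    show "emeasure lebesgue (B i) \<noteq> \<infinity>" for i using fmeasurableD2[OF B_meas] by simp
  qed
  then have "\<kappa> \<le> measure lebesgue (\<Inter>n. B n)"
    using B_ge by (intro LIMSEQ_le_const) auto
  moreover have "(\<Inter>n. B n) \<subseteq> ?L"
  proof
    fix x assume x: "x \<in> (\<Inter>n. B n)"
    have "\<exists>q>n. nid (real q *\<^sub>R x) < \<psi> q" for n
    proof -
      obtain q where "q > n" "x \<in> near_rational q (\<psi> q)" using x by (auto simp: B_def)
      then show ?thesis using near_rational_imp_nid_less[of x q] by auto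
    qed
    then show "x \<in> ?L" unfolding frequently_sequentially by (auto intro: less_imp_le)
  qed
  then have "measure lebesgue (\<Inter>n. B n) = 0"
    using neg negligible_subset negligible_imp_measure0 by blast
  ultimately have "\<kappa> \<le> 0" by simp
  moreover have "\<kappa> > 0" unfolding \<kappa>_def by (intro divide_pos_pos mult_pos_pos add_pos_pos zero_less_power) auto
  ultimately show False by simp
qed

lemma int_periodic_limsup:
  "int_periodic {x. \<forall>\<epsilon>>0. \<exists>\<^sub>F q in sequentially. nid (real q *\<^sub>R x) < \<epsilon> * \<psi> q}"
  by (auto simp: int_periodic_def scaleR_add_right int_vec_scaleR)

text \<open>The set on which \<open>nid (q x) / \<psi> q\<close> has lower limit 0 is invariant under doubling, unlike the one on
  which it is infinitely often below 1. It still has positive measure by the Abel--Dini theorem.\<close>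

theorem gallagher:
  fixes \<psi> :: "nat \<Rightarrow> real"
  assumes d: "CARD('d::finite) \<ge> 2" and \<psi>: "\<And>q. 0 \<le> \<psi> q"
    and div: "\<not> summable (\<lambda>q. \<psi> q ^ CARD('d))"
  shows "AE x in lebesgue. \<exists>\<^sub>F q in sequentially. nid (real q *\<^sub>R (x :: real ^ 'd)) < \<psi> q"
proof -
  \<comment> \<open>Truncation at 1/2 makes the cubes with equal denominator disjoint. Divergence
    survives: if the truncated series converged, its terms would tend to 0 and the truncation would
    be inactive from some point on.\<close>
  define \<phi> where "\<phi> q = min (\<psi> q) (1 / 2)" for q
  have \<phi>: "0 \<le> \<phi> q" "\<phi> q \<le> 1 / 2" "\<phi> q \<le> \<psi> q" for q using \<psi>[of q] by (auto simp: \<phi>_def)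
  have div_\<phi>: "\<not> summable (\<lambda>q. \<phi> q ^ CARD('d))"
  proof
    assume sum: "summable (\<lambda>q. \<phi> q ^ CARD('d))"
    then have "(\<lambda>q. \<phi> q ^ CARD('d)) \<longlonglongrightarrow> 0" by (rule summable_LIMSEQ_zero)
    then have "\<forall>\<^sub>F q in sequentially. \<phi> q ^ CARD('d) < (1 / 2) ^ CARD('d)"
      by (rule order_tendstoD) simp
    then have "\<forall>\<^sub>F q in sequentially. norm (\<psi> q ^ CARD('d)) \<le> \<phi> q ^ CARD('d)"
    proof eventually_elim
      case (elim q)
      then have "\<phi> q \<noteq> 1 / 2" by (metis less_irrefl)
      then have "\<phi> q = \<psi> q" by (auto simp: \<phi>_def min_def split: if_splits)
      then show ?case using \<psi>[of q] by simp
    qed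
    then have "summable (\<lambda>q. \<psi> q ^ CARD('d))"
      using sum by (rule summable_comparison_test_ev)
    then show False using div by simp
  qed
  obtain \<eta> where \<eta>: "\<And>q. 0 < \<eta> q" "\<And>q. \<eta> q \<le> 1" "\<eta> \<longlonglongrightarrow> 0"
    and div_\<eta>: "\<not> summable (\<lambda>q. \<eta> q * \<phi> q ^ CARD('d))"
    using abel_dini[OF _ div_\<phi>] \<phi>(1) by (metis zero_le_power)
  \<comment> \<open>The root makes \<open>(\<rho> q * \<phi> q) ^ d\<close> the Abel-Dini series,
    and \<open>\<rho>\<close> still tends to 0. So infinitely many solutions for
    \<open>\<rho> q * \<phi> q\<close> yield infinitely many for
    \<open>\<epsilon> * \<phi> q\<close>, whatever the value of \<open>\<epsilon>\<close>.\<close>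
  define \<rho> where "\<rho> q = root CARD('d) (\<eta> q)" for q
  have \<rho>: "0 < \<rho> q" "\<rho> q \<le> 1" for q using \<eta>(1,2)[of q] by (auto simp: \<rho>_def real_root_le_1_iff)
  have \<rho>_lim: "\<rho> \<longlonglongrightarrow> 0" unfolding \<rho>_def using tendsto_real_root[OF \<eta>(3), of "CARD('d)"] by simp
  have "(\<rho> q * \<phi> q) ^ CARD('d) = \<eta> q * \<phi> q ^ CARD('d)" for q
    using \<eta>(1)[of q] by (simp add: power_mult_distrib \<rho>_def real_root_pow_pos2 less_imp_le)
  then have L: "\<not> negligible {x :: real ^ 'd. \<exists>\<^sub>F q in sequentially. nid (real q *\<^sub>R x) < \<rho> q * \<phi> q}"
    (is "\<not> negligible ?L")
  proof (intro not_negligible_limsup d)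
    show "0 \<le> \<rho> q * \<phi> q" for q using \<rho>(1)[of q] \<phi>(1)[of q] by simp
    have "\<rho> q * \<phi> q \<le> 1 * (1 / 2)" for q
      using \<rho>[of q] \<phi>[of q] by (intro mult_mono) auto
    then show "\<rho> q * \<phi> q \<le> 1 / 2" for q by simp
  qed (use div_\<eta> in simp)
  define U where "U = {x :: real ^ 'd. \<forall>\<epsilon>>0. \<exists>\<^sub>F q in sequentially. nid (real q *\<^sub>R x) < \<epsilon> * \<phi> q}"
  have "?L \<subseteq> U"
    unfolding U_def
  proof clarify
    fix x :: "real ^ 'd" and \<epsilon> :: real
    assume x: "\<exists>\<^sub>F q in sequentially. nid (real q *\<^sub>R x) < \<rho> q * \<phi> q" and "\<epsilon> > 0"
    then have "\<forall>\<^sub>F q in sequentially. \<rho> q < \<epsilon>" using \<rho>_lim by (intro order_tendstoD)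
    then show "\<exists>\<^sub>F q in sequentially. nid (real q *\<^sub>R x) < \<epsilon> * \<phi> q"
      by (rule frequently_rev_mp[OF x, OF eventually_mono])
         (metis \<phi>(1) less_imp_le less_le_trans mult_right_mono)
  qed
  then have "\<not> negligible U" using L negligible_subset by blast
  moreover have "U \<in> sets lebesgue"
  proof -
    \<comment> \<open>The thresholds \<open>1 / Suc m\<close> suffice because \<open>\<phi>\<close>
      is nonnegative; this leaves countable operations on open sets.\<close>
    have "U = (\<Inter>m. \<Inter>n. \<Union>q\<in>{n..}. {x. nid (real q *\<^sub>R x) < 1 / real (Suc m) * \<phi> q})"
    proof (intro equalityI subsetI)
      fix x assume x: "x \<in> U"
      have "\<exists>q\<ge>n. nid (real q *\<^sub>R x) < 1 / real (Suc m) * \<phi> q" for m n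
      proof -
        have "\<exists>\<^sub>F q in sequentially. nid (real q *\<^sub>R x) < 1 / real (Suc m) * \<phi> q"
          using x zero_less_divide_1_iff of_nat_0_less_iff zero_less_Suc unfolding U_def by blast
        then show ?thesis by (simp only: frequently_sequentially)
      qed
      then show "x \<in> (\<Inter>m. \<Inter>n. \<Union>q\<in>{n..}. {x. nid (real q *\<^sub>R x) < 1 / real (Suc m) * \<phi> q})"
        by (simp only: INT_iff UN_iff mem_Collect_eq atLeast_iff) blast
    next
      fix x :: "real ^ 'd" assume x: "x \<in> (\<Inter>m. \<Inter>n. \<Union>q\<in>{n..}. {x. nid (real q *\<^sub>R x) < 1 / real (Suc m) * \<phi> q})"
      show "x \<in> U"
        unfolding U_def frequently_sequentially
      proof clarify
        fix \<epsilon> :: real and n assume "\<epsilon> > 0"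
        then obtain m where m: "1 / real (Suc m) < \<epsilon>" using nat_approx_posE by blast
        obtain q where q: "q \<ge> n" "nid (real q *\<^sub>R x) < 1 / real (Suc m) * \<phi> q"
          using x by (auto simp del: of_nat_Suc)
        have "1 / real (Suc m) * \<phi> q \<le> \<epsilon> * \<phi> q" using m \<phi>(1) by (intro mult_right_mono) auto
        then show "\<exists>q\<ge>n. nid (real q *\<^sub>R x) < \<epsilon> * \<phi> q" using q by (meson less_le_trans)
      qed
    qed
    also have "\<dots> \<in> sets borel"
      by (intro sets.countable_INT'' sets.countable_UN'' borel_open open_nid_less continuous_intros) auto
    finally show ?thesis by simp
  qed
  moreover have "2 *\<^sub>R x \<in> U" if x: "x \<in> U" for x
    unfolding U_def
  proof clarify
    fix \<epsilon> :: real assume "\<epsilon> > 0"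
    then have "\<exists>\<^sub>F q in sequentially. nid (real q *\<^sub>R x) < \<epsilon> / 2 * \<phi> q"
      using x half_gt_zero unfolding U_def by blast
    then show "\<exists>\<^sub>F q in sequentially. nid (real q *\<^sub>R 2 *\<^sub>R x) < \<epsilon> * \<phi> q"
    proof (rule frequently_elim1)
      fix q assume "nid (real q *\<^sub>R x) < \<epsilon> / 2 * \<phi> q"
      moreover have "nid (real 2 *\<^sub>R (real q *\<^sub>R x)) \<le> real 2 * nid (real q *\<^sub>R x)"
        by (rule nid_scaleR_le)
      ultimately show "nid (real q *\<^sub>R 2 *\<^sub>R x) < \<epsilon> * \<phi> q"
        by (simp add: mult.commute)
    qed
  qed
  moreover have "int_periodic U" unfolding U_def by (rule int_periodic_limsup)
  ultimately have "negligible (- U)" using doubling_zero_one by blast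
  then have "AE x in lebesgue. x \<in> U"
    using AE_not_in[of "- U" lebesgue] by (simp add: negligible_iff_null_sets)
  then show ?thesis
  proof (rule AE_mp, intro AE_I2 impI)
    fix x assume "x \<in> U"
    then have "\<exists>\<^sub>F q in sequentially. nid (real q *\<^sub>R x) < 1 * \<phi> q"
      unfolding U_def using zero_less_one by blast
    then show "\<exists>\<^sub>F q in sequentially. nid (real q *\<^sub>R x) < \<psi> q"
      by (rule frequently_elim1) (metis \<phi>(3) less_le_trans mult_1)
  qed
qed

section \<open>Difference sets and their series\<close>

lemma ln_gt_1:
  assumes "16 \<le> (x :: real)"
  shows "1 < ln x" "0 < ln (ln x)"
proof -
  have "exp 1 < x" using assms exp_le by linarith
  then show "1 < ln x" using assms by (metis ln_exp ln_less_cancel_iff exp_gt_zero less_trans)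
  then show "0 < ln (ln x)" by simp
qed

lemma bertrand_mono:
  assumes "16 \<le> (x :: real)" "x \<le> y" "0 \<le> s"
  shows "x * ln x * ln (ln x) powr s \<le> y * ln y * ln (ln y) powr s"
  using ln_gt_1[of x] assms by (intro mult_mono powr_mono2) auto

lemma bertrand_pos:
  assumes "16 \<le> (x :: real)"
  shows "0 < x * ln x * ln (ln x) powr s"
  using ln_gt_1[of x] assms by (intro mult_pos_pos) auto

text \<open>Integral test by telescoping: \<open>F\<close> is an antiderivative of \<open>v\<close>
  that stays below 0, and the mean value theorem compares \<open>v (x + 1)\<close> with the
  increment of \<open>F\<close>. As \<open>v\<close> is evaluated at the right end of each interval,
  the shift is 17 rather than 16.\<close>

lemma summable_bertrand:
  assumes "\<eta> > 0"
  shows "summable (\<lambda>j. 1 / ((real j + 17) * ln (real j + 17) * ln (ln (real j + 17)) powr (1 + \<eta>)))"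
proof -
  define v where "v x = 1 / (x * ln x * ln (ln x) powr (1 + \<eta>))" for x :: real
  define F where "F x = - (1 / \<eta>) * ln (ln x) powr (- \<eta>)" for x :: real
  have F': "(F has_real_derivative v x) (at x)" if "16 \<le> x" for x
    unfolding F_def v_def using ln_gt_1[OF that] that assms
    by (auto intro!: derivative_eq_intros simp: powr_add powr_minus powr_diff field_simps)
  have step: "v (x + 1) \<le> F (x + 1) - F x" if x: "16 \<le> x" for x
  proof -
    obtain z where z: "x < z" "z < x + 1" "F (x + 1) - F x = (x + 1 - x) * v z"
      using MVT2[of x "x + 1" F v] F' x by auto
    have "v (x + 1) \<le> v z"
      unfolding v_def using z x assms bertrand_pos[of z "1 + \<eta>"]
      by (intro divide_left_mono bertrand_mono mult_pos_pos[OF bertrand_pos]) auto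
    then show ?thesis using z by simp
  qed
  have "(\<Sum>j\<le>n. v (real j + 17)) \<le> 1 / \<eta> * ln (ln 16) powr (- \<eta>)" for n
  proof -
    have "(\<Sum>j\<le>n. v (real j + 17)) \<le> (\<Sum>j\<le>n. F (real (Suc j) + 16) - F (real j + 16))"
    proof (rule sum_mono)
      fix j show "v (real j + 17) \<le> F (real (Suc j) + 16) - F (real j + 16)"
        using step[of "real j + 16"] by (simp add: add.commute)
    qed
    also have "\<dots> = F (real (Suc n) + 16) - F (real 0 + 16)"
      using sum_telescope[of "\<lambda>j. - F (real j + 16)" n] by simp
    also have "\<dots> \<le> 1 / \<eta> * ln (ln 16) powr (- \<eta>)"
      using assms by (simp add: F_def)
    finally show ?thesis .
  qed
  then have "summable (\<lambda>j. v (real j + 17))"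
    using bertrand_pos by (intro bounded_imp_summable) (auto simp: v_def less_imp_le)
  then show ?thesis by (simp add: v_def)
qed

text \<open>The antiderivative is now \<open>ln (ln (ln x))\<close>, which is unbounded. The left
  end of each interval is used, so the shift is 16.\<close>

lemma not_summable_bertrand:
  "\<not> summable (\<lambda>j. 1 / ((real j + 16) * ln (real j + 16) * ln (ln (real j + 16))))"
proof
  define w where "w x = 1 / (x * ln x * ln (ln x))" for x :: real
  define G where "G x = ln (ln (ln x))" for x :: real
  assume "summable (\<lambda>j. 1 / ((real j + 16) * ln (real j + 16) * ln (ln (real j + 16))))"
  then have sum: "summable (\<lambda>j. w (real j + 16))" by (simp add: w_def)
  have G': "(G has_real_derivative w x) (at x)" if "16 \<le> x" for x
    unfolding G_def w_def using ln_gt_1[OF that] that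
    by (auto intro!: derivative_eq_intros simp: field_simps)
  have step: "G (x + 1) - G x \<le> w x" if x: "16 \<le> x" for x
  proof -
    obtain z where z: "x < z" "z < x + 1" "G (x + 1) - G x = (x + 1 - x) * w z"
      using MVT2[of x "x + 1" G w] G' x by auto
    have "w z \<le> w x"
      unfolding w_def using z x ln_gt_1[of x] ln_gt_1[of z]
      by (intro divide_left_mono mult_mono mult_pos_pos) auto
    then show ?thesis using z by simp
  qed
  have le: "G (real n + 16) - G 16 \<le> (\<Sum>j. w (real j + 16))" for n
  proof -
    have "G (real n + 16) - G 16 = (\<Sum>j<n. G (real (Suc j) + 16) - G (real j + 16))"
      by (subst sum_lessThan_telescope) simp
    also have "\<dots> \<le> (\<Sum>j<n. w (real j + 16))"
    proof (rule sum_mono)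
      fix j show "G (real (Suc j) + 16) - G (real j + 16) \<le> w (real j + 16)"
        using step[of "real j + 16"] by (simp add: add_ac)
    qed
    also have "\<dots> \<le> (\<Sum>j. w (real j + 16))"
      using ln_gt_1 sum by (intro sum_le_suminf) (auto simp: w_def intro!: mult_nonneg_nonneg less_imp_le)
    finally show ?thesis .
  qed
  have "filterlim (\<lambda>n. G (real n + 16)) at_top sequentially"
    unfolding G_def by real_asymp
  then have "\<forall>\<^sub>F n in sequentially. (\<Sum>j. w (real j + 16)) + G 16 + 1 \<le> G (real n + 16)"
    by (simp add: filterlim_at_top)
  then obtain n where "(\<Sum>j. w (real j + 16)) + G 16 + 1 \<le> G (real n + 16)"
    using eventually_happens' sequentially_bot by blast
  then show False using le[of n] by simp
qed

text \<open>Brings the thresholds of both bounds into the form of a \<open>d\<close>-th root of a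
  Bertrand term; the second bound is the case \<open>\<epsilon> = 0\<close>.\<close>

lemma threshold_eq:
  fixes C L LL :: real
  assumes "0 \<le> C" "0 \<le> L" "0 \<le> LL" "0 < d"
  shows "1 / (C powr (1 / d) * L powr (1 / d) * LL powr (1 / d + \<epsilon>))
    = (1 / (C * L * LL powr (1 + d * \<epsilon>))) powr (1 / d)"
proof -
  have "(1 + d * \<epsilon>) * (1 / d) = 1 / d + \<epsilon>" using assms by (simp add: field_simps)
  then show ?thesis using assms by (simp add: powr_divide powr_mult powr_powr)
qed

section \<open>Minimal gaps modulo the integer lattice\<close>

lemma finite_gaps:
  fixes N :: nat
  shows "finite {nid (x n - x m) | n m. n \<in> {1..N} \<and> m \<in> {1..N} \<and> m \<noteq> n}"
  by (rule finite_subset[of _ "(\<lambda>(n, m). nid (x n - x m)) ` ({1..N} \<times> {1..N})"]) auto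

lemma min_gap_le:
  assumes "n \<in> {1..N}" "m \<in> {1..N}" "m \<noteq> n"
  shows "min_gap x N \<le> nid (x n - x m)"
  unfolding min_gap_def using assms by (intro Min_le finite_gaps) auto

lemma min_gap_ge:
  assumes N: "N \<ge> 2" and t: "\<And>m n. 1 \<le> m \<Longrightarrow> m < n \<Longrightarrow> n \<le> N \<Longrightarrow> t \<le> nid (x n - x m)"
  shows "t \<le> min_gap x N"
  unfolding min_gap_def
proof (rule Min.boundedI[OF finite_gaps])
  have "nid (x 2 - x 1) \<in> {nid (x n - x m) | n m. n \<in> {1..N} \<and> m \<in> {1..N} \<and> m \<noteq> n}"
    using N by force
  then show "{nid (x n - x m) | n m. n \<in> {1..N} \<and> m \<in> {1..N} \<and> m \<noteq> n} \<noteq> {}" by blast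
  fix g assume "g \<in> {nid (x n - x m) | n m. n \<in> {1..N} \<and> m \<in> {1..N} \<and> m \<noteq> n}"
  then obtain n m where nm: "g = nid (x n - x m)" "n \<in> {1..N}" "m \<in> {1..N}" "m \<noteq> n" by auto
  show "t \<le> g"
  proof (cases "m < n")
    case True
    then show ?thesis using t nm by auto
  next
    case False
    then have "t \<le> nid (x m - x n)" using t nm by auto
    then show ?thesis using nid_minus[of "x n - x m"] by (simp add: nm)
  qed
qed

lemma nid_frac_vec_diff: "nid (frac_vec x - frac_vec y) = nid (x - y)"
proof -
  have "frac_vec x - frac_vec y = (x - y) + int_vec (\<chi> i. \<lfloor>y $ i\<rfloor> - \<lfloor>x $ i\<rfloor>)"
    by (simp add: frac_vec_def int_vec_def frac_def vec_eq_iff)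
  then show ?thesis by (simp only: nid_add_int_vec)
qed

section \<open>Counting positive differences\<close>

lemma pos_diffs_vecI:
  assumes "x \<in> A" "y \<in> A" "\<And>i. y $ i < x $ i"
  shows "x - y \<in> pos_diffs_vec A"
  unfolding pos_diffs_vec_def using assms by (intro CollectI conjI bexI[of _ x] bexI[of _ y]) auto

lemma pos_diffsI:
  assumes "x \<in> A" "y \<in> A" "y < x"
  shows "x - y \<in> pos_diffs A"
  unfolding pos_diffs_def using assms by (intro CollectI conjI bexI[of _ x] bexI[of _ y]) auto

lemma pos_diffs_vec_subset: "pos_diffs_vec A \<subseteq> (\<lambda>(x, y). x - y) ` (A \<times> A)"
  by (auto simp: pos_diffs_vec_def)

lemma pos_diffs_subset: "pos_diffs A \<subseteq> (\<lambda>(x, y). x - y) ` (A \<times> A)"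
  by (auto simp: pos_diffs_def)

lemma card_pos_diffs_vec_le:
  "card_pos_diffs_vec b N \<le> N\<^sup>2"
proof -
  have "card (pos_diffs_vec (b ` {1..N})) \<le> card ((\<lambda>(x, y). x - y) ` (b ` {1..N} \<times> b ` {1..N}))"
    by (intro card_mono pos_diffs_vec_subset) auto
  also have "\<dots> \<le> card (b ` {1..N} \<times> b ` {1..N})" by (intro card_image_le) auto
  also have "\<dots> = card (b ` {1..N}) * card (b ` {1..N})" by (rule card_cartesian_product)
  also have "\<dots> \<le> N * N" using card_image_le[of "{1..N}" b] by (intro mult_le_mono) auto
  finally show ?thesis by (simp add: card_pos_diffs_vec_def power2_eq_square)
qed

lemma card_pos_diffs_vec_ge:
  fixes a :: "'d::finite \<Rightarrow> nat \<Rightarrow> nat"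
  assumes a: "\<And>i. strict_mono_on {1..} (a i)"
  shows "N - 1 \<le> card_pos_diffs_vec (vec_seq a) N"
proof (cases "N \<ge> 1")
  case True
  define f where "f n = vec_seq a n - vec_seq a 1" for n
  have "inj_on f {2..N}"
  proof (rule inj_onI)
    fix m n assume mn: "m \<in> {2..N}" "n \<in> {2..N}" and eq: "f m = f n"
    fix i :: 'd
    have "a i m = a i n" using eq by (simp add: f_def vec_seq_def vec_eq_iff)
    moreover have "inj_on (a i) {1..}" using a by (rule strict_mono_on_imp_inj_on)
    ultimately show "m = n" using mn by (auto dest: inj_onD)
  qed
  moreover have "f ` {2..N} \<subseteq> pos_diffs_vec (vec_seq a ` {1..N})"
  proof (rule image_subsetI)
    fix n assume n: "n \<in> {2..N}"
    have "vec_seq a 1 $ i < vec_seq a n $ i" for i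
      using strict_mono_onD[OF a[of i], of 1 n] n by (simp add: vec_seq_def)
    then show "f n \<in> pos_diffs_vec (vec_seq a ` {1..N})"
      unfolding f_def using n True by (intro pos_diffs_vecI imageI) auto
  qed
  moreover have "finite (pos_diffs_vec (vec_seq a ` {1..N}))"
    by (rule finite_subset[OF pos_diffs_vec_subset]) auto
  ultimately have "card {2..N} \<le> card (pos_diffs_vec (vec_seq a ` {1..N}))"
    by (intro card_inj_on_le)
  then show ?thesis by (simp add: card_pos_diffs_vec_def)
qed simp

text \<open>As the sequence is not assumed monotone, differences are taken to the smallest of the
  \<open>N\<close> terms instead of the first.\<close>

lemma card_pos_diffs_ge:
  assumes a: "inj_on a {1..}"
  shows "N - 1 \<le> card_pos_diffs a N"
proof (cases "N \<ge> 1")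
  case True
  define A where "A = a ` {1..N}"
  have A: "finite A" "A \<noteq> {}" using True by (auto simp: A_def)
  have "(\<lambda>x. x - Min A) ` (A - {Min A}) \<subseteq> pos_diffs A"
  proof (rule image_subsetI)
    fix x assume x: "x \<in> A - {Min A}"
    then have "Min A < x" using A by (simp add: order_less_le)
    then show "x - Min A \<in> pos_diffs A" using A x by (intro pos_diffsI Min_in) auto
  qed
  moreover have "inj_on (\<lambda>x. x - Min A) (A - {Min A})" by (auto intro: inj_onI)
  moreover have "finite (pos_diffs A)"
    using A by (intro finite_subset[OF pos_diffs_subset]) auto
  ultimately have "card (A - {Min A}) \<le> card (pos_diffs A)" by (intro card_inj_on_le)
  moreover have "card A = N"
    unfolding A_def using inj_on_subset[OF a] by (subst card_image) auto
  ultimately show ?thesis using A by (simp add: card_pos_diffs_def A_def)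
qed simp

text \<open>A new term forms at most one positive difference with each earlier one. This limits how
  far \<open>C N\<close> can overshoot \<open>j\<close> at the moment when \<open>e j\<close> first
  appears in \<open>AE_min_gap_int_le\<close>.\<close>

lemma card_pos_diffs_Suc_le:
  "card_pos_diffs a (Suc N) \<le> card_pos_diffs a N + N"
proof -
  have "pos_diffs (a ` {1..Suc N}) \<subseteq> pos_diffs (a ` {1..N}) \<union> (\<lambda>m. \<bar>a (Suc N) - a m\<bar>) ` {1..N}"
  proof
    fix c assume "c \<in> pos_diffs (a ` {1..Suc N})"
    then obtain m n where c: "c > 0" "c = a n - a m" "m \<in> {1..Suc N}" "n \<in> {1..Suc N}"
      by (auto simp: pos_diffs_def)
    then consider "m \<in> {1..N}" "n \<in> {1..N}" | "m \<in> {1..N}" "n = Suc N" | "m = Suc N" "n \<in> {1..N}"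
      by (force simp: le_Suc_eq)
    then show "c \<in> pos_diffs (a ` {1..N}) \<union> (\<lambda>m. \<bar>a (Suc N) - a m\<bar>) ` {1..N}"
    proof cases
      case 1
      then have "c \<in> pos_diffs (a ` {1..N})" unfolding c(2) using c by (intro pos_diffsI) auto
      then show ?thesis by blast
    next
      case 2
      then have "c = \<bar>a (Suc N) - a m\<bar>" using c by simp
      then show ?thesis using 2 by blast
    next
      case 3
      then have "c = \<bar>a (Suc N) - a n\<bar>" using c by simp
      then show ?thesis using 3 by blast
    qed
  qed
  then have "card (pos_diffs (a ` {1..Suc N}))
      \<le> card (pos_diffs (a ` {1..N}) \<union> (\<lambda>m. \<bar>a (Suc N) - a m\<bar>) ` {1..N})"
    by (intro card_mono finite_UnI finite_subset[OF pos_diffs_subset]) auto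
  also have "\<dots> \<le> card (pos_diffs (a ` {1..N})) + card ((\<lambda>m. \<bar>a (Suc N) - a m\<bar>) ` {1..N})"
    by (rule card_Un_le)
  also have "card ((\<lambda>m. \<bar>a (Suc N) - a m\<bar>) ` {1..N}) \<le> N"
    using card_image_le[of "{1..N}" "\<lambda>m. \<bar>a (Suc N) - a m\<bar>"] by simp
  finally show ?thesis by (simp add: card_pos_diffs_def)
qed

section \<open>Measure of a single approximation event\<close>

lemma int_vec_times: "int_vec c * x = (\<chi> i. real_of_int (c $ i) * x $ i)"
  by (simp add: int_vec_def vec_eq_iff)

lemma open_nid_times_less: "open {x :: real ^ 'd::finite. nid (int_vec c * x) < t}"
  unfolding int_vec_times by (intro open_nid_less continuous_intros)

text \<open>In coordinate \<open>i\<close> the set lies in \<open>c $ i + 1\<close> intervals of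
  length \<open>2 * t / c $ i\<close>, one around each multiple of \<open>1 / c $ i\<close> in the
  unit interval. As \<open>c $ i + 1 <= 2 * c $ i\<close>, every coordinate contributes a factor of
  at most \<open>4 * t\<close>, whatever the size of \<open>c\<close>.\<close>

lemma measure_nid_times_less_le:
  fixes c :: "int ^ 'd::finite"
  assumes c: "\<And>i. c $ i > 0" and "0 \<le> t"
  shows "measure lebesgue ({x. nid (int_vec c * x) < t} \<inter> cbox 0 1) \<le> (4 * t) ^ CARD('d)"
proof (cases "t \<le> 1")
  case False
  have "measure lebesgue ({x. nid (int_vec c * x) < t} \<inter> cbox 0 1) \<le> measure lebesgue (cbox (0 :: real ^ 'd) 1)"
    by (intro measure_mono_fmeasurable) (auto simp: open_nid_times_less borel_open)
  also have "\<dots> = 1 ^ CARD('d)" by (intro measure_lebesgue_cbox_cart) auto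
  also have "\<dots> \<le> (4 * t) ^ CARD('d)" using False by (intro power_mono) auto
  finally show ?thesis .
next
  case True
  with \<open>0 \<le> t\<close> have t: "0 \<le> t" "t \<le> 1" by auto
  \<comment> \<open>For \<open>t <= 1\<close>, an integer at distance less than \<open>t\<close>
    from a point of \<open>[0, c $ i]\<close> lies in that interval itself. For larger
    \<open>t\<close> the asserted bound exceeds 1 and is trivial.\<close>
  define P where "P = {p :: int ^ 'd. \<forall>i. p $ i \<in> {0..c $ i}}"
  define B where "B p = cbox (\<chi> i. (real_of_int (p $ i) - t) / real_of_int (c $ i))
      (\<chi> i. (real_of_int (p $ i) + t) / real_of_int (c $ i))" for p :: "int ^ 'd"
  have "finite P" unfolding P_def by (rule finite_vec_Collect) simp
  have B: "measure lebesgue (B p) = (\<Prod>i\<in>UNIV. 2 * t / real_of_int (c $ i))" for p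
  proof -
    have "measure lborel (B p) = (\<Prod>i\<in>UNIV. 2 * t / real_of_int (c $ i))"
      unfolding B_def using c t
      by (subst content_cbox_cart)
         (auto simp: interval_ne_empty_cart divide_right_mono less_imp_le simp flip: diff_divide_distrib)
    then show ?thesis by (simp add: B_def)
  qed
  have "{x. nid (int_vec c * x) < t} \<inter> cbox 0 1 \<subseteq> (\<Union>p\<in>P. B p)"
  proof
    fix x assume x: "x \<in> {x. nid (int_vec c * x) < t} \<inter> cbox 0 1"
    then obtain k where "infnorm (int_vec c * x + int_vec k) < t" by (auto simp: nid_less_iff)
    then have k: "\<bar>real_of_int (c $ i) * x $ i + real_of_int (k $ i)\<bar> < t" for i
      by (auto simp: infnorm_less_iff int_vec_def)
    have "- k \<in> P"
      unfolding P_def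
    proof (clarify)
      fix i
      have "0 \<le> real_of_int (c $ i) * x $ i" "real_of_int (c $ i) * x $ i \<le> real_of_int (c $ i) * 1"
        using x c[of i] by (auto simp: mem_box_cart intro!: mult_left_mono)
      then have "real_of_int (k $ i) < 1" "- 1 < real_of_int (k $ i) + real_of_int (c $ i)"
        using k[of i] t by linarith+
      then show "(- k) $ i \<in> {0..c $ i}" by auto
    qed
    moreover have "x \<in> B (- k)"
      unfolding B_def mem_box_cart
    proof (intro allI conjI)
      fix i
      show "(\<chi> i. (real_of_int ((- k) $ i) - t) / real_of_int (c $ i)) $ i \<le> x $ i"
        "x $ i \<le> (\<chi> i. (real_of_int ((- k) $ i) + t) / real_of_int (c $ i)) $ i"
        using k[of i] c[of i] by (auto simp: pos_divide_le_eq pos_le_divide_eq mult.commute abs_less_iff)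
    qed
    ultimately show "x \<in> (\<Union>p\<in>P. B p)" by blast
  qed
  then have "measure lebesgue ({x. nid (int_vec c * x) < t} \<inter> cbox 0 1) \<le> measure lebesgue (\<Union>p\<in>P. B p)"
    using \<open>finite P\<close> by (intro measure_mono_fmeasurable fmeasurable.finite_UN)
      (auto simp: B_def open_nid_times_less borel_open)
  also have "\<dots> \<le> (\<Sum>p\<in>P. measure lebesgue (B p))"
    using \<open>finite P\<close> by (intro measure_UNION_le) (auto simp: B_def)
  also have "\<dots> = real (card P) * (\<Prod>i\<in>UNIV. 2 * t / real_of_int (c $ i))"
    by (simp only: B sum_constant)
  also have "\<dots> = (\<Prod>i\<in>UNIV. real (nat (c $ i + 1)) * (2 * t / real_of_int (c $ i)))"
    unfolding P_def card_vec_Collect by (simp only: prod.distrib of_nat_prod card_atLeastAtMost_int diff_zero)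
  also have "\<dots> \<le> (\<Prod>i\<in>(UNIV :: 'd set). 4 * t)"
  proof (rule prod_mono)
    fix i :: 'd
    have "real (nat (c $ i + 1)) * (2 * t) \<le> (2 * real_of_int (c $ i)) * (2 * t)"
      using c[of i] t by (intro mult_right_mono) auto
    then show "0 \<le> real (nat (c $ i + 1)) * (2 * t / real_of_int (c $ i)) \<and>
        real (nat (c $ i + 1)) * (2 * t / real_of_int (c $ i)) \<le> 4 * t"
      using c[of i] t by (simp add: pos_divide_le_eq less_imp_le mult_ac)
  qed
  finally show ?thesis by simp
qed

section \<open>The metric bounds\<close>

text \<open>The later term minus the earlier one is positive in all components, so the gap is
  controlled by the \<open>e j\<close> with \<open>j < C N\<close>. Borel-Cantelli handles all large
  \<open>j\<close> at once. For the finitely many others \<open>nid\<close> is bounded away from 0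
  if \<open>\<alpha>\<close> avoids a countable set, while the threshold tends to 0.\<close>

lemma AE_min_gap_vec_ge:
  fixes a :: "'d::finite \<Rightarrow> nat \<Rightarrow> nat"
  assumes \<epsilon>: "\<epsilon> > 0" and a: "\<And>i. strict_mono_on {1..} (a i)"
  shows "AE \<alpha>\<in>cbox (0 :: real ^ 'd) 1 in lebesgue. \<forall>\<^sub>F N in sequentially.
          min_gap_vec_seq (vec_seq a) \<alpha> N \<ge>
            1 / (real (card_pos_diffs_vec (vec_seq a) N) powr (1 / real CARD('d))
                 * ln (real N) powr (1 / real CARD('d))
                 * ln (ln (real N)) powr (1 / real CARD('d) + \<epsilon>))"
proof -
  define d where "d = real CARD('d)"
  \<comment> \<open>Half of the extra exponent \<open>d * \<epsilon>\<close> secures convergence;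
    the other half absorbs the constants from comparing \<open>j\<close> with
    \<open>N\<close>.\<close>
  define \<eta> where "\<eta> = d * \<epsilon> / 2"
  have d: "d > 0" and \<eta>: "\<eta> > 0" using \<epsilon> by (auto simp: d_def \<eta>_def)
  define b where "b = vec_seq a"
  define D where "D N = pos_diffs_vec (b ` {1..N})" for N
  define C where "C N = card (D N)" for N
  have C_eq: "card_pos_diffs_vec b N = C N" for N by (simp add: card_pos_diffs_vec_def C_def D_def)
  have C_ge: "N - 1 \<le> C N" for N
    using card_pos_diffs_vec_ge[of a N] a by (simp add: C_eq flip: b_def)
  have C_le: "C N \<le> N\<^sup>2" for N using card_pos_diffs_vec_le[of b N] by (simp add: C_eq)
  have "mono D"
    unfolding D_def pos_diffs_vec_def by (intro monoI) force
  moreover have "finite (D N)" for N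
    unfolding D_def by (rule finite_subset[OF pos_diffs_vec_subset]) auto
  moreover have "\<exists>N. m < card (D N)" for m
    using C_ge[of "m + 2"] by (intro exI[of _ "m + 2"]) (auto simp: C_def)
  ultimately obtain e where e: "inj e" "\<And>N. D N = e ` {..<C N}"
    unfolding C_def by (rule enumerate_chain) blast+
  have e_pos: "e j $ i > 0" for j i
  proof -
    have "e j \<in> D (j + 2)" using C_ge[of "j + 2"] by (auto simp: e(2))
    then show ?thesis by (simp add: D_def pos_diffs_vec_def)
  qed
  define v where "v j = 1 / ((real j + 17) * ln (real j + 17) * ln (ln (real j + 17)) powr (1 + \<eta>))" for j
  have v_pos: "0 < v j" for j unfolding v_def using bertrand_pos[of "real j + 17"] by simp
  define \<delta> where "\<delta> j = v j powr (1 / d)" for j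
  define A where "A j = {\<alpha> :: real ^ 'd. nid (int_vec (e j) * \<alpha>) < \<delta> j} \<inter> cbox 0 1" for j
  have A_meas: "A j \<in> lmeasurable" for j
    unfolding A_def by (intro bounded_set_imp_lmeasurable)
      (auto simp: open_nid_times_less borel_open intro: bounded_subset[OF bounded_cbox])
  have "summable (\<lambda>j. measure lebesgue (A j))"
  proof (rule summable_comparison_test)
    have "summable v" unfolding v_def using summable_bertrand[OF \<eta>] .
    then show "summable (\<lambda>j. 4 ^ CARD('d) * v j)" by (rule summable_mult)
    have "measure lebesgue (A j) \<le> 4 ^ CARD('d) * v j" for j
    proof -
      have "measure lebesgue (A j) \<le> (4 * \<delta> j) ^ CARD('d)"
        unfolding A_def using e_pos by (intro measure_nid_times_less_le) (auto simp: \<delta>_def)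
      also have "\<dots> = 4 ^ CARD('d) * \<delta> j ^ CARD('d)" by (rule power_mult_distrib)
      also have "\<delta> j ^ CARD('d) = v j"
        using v_pos[of j] unfolding \<delta>_def d_def by (simp add: powr_powr flip: powr_realpow)
      finally show ?thesis .
    qed
    then show "\<exists>N. \<forall>n\<ge>N. norm (measure lebesgue (A n)) \<le> 4 ^ CARD('d) * v n" by simp
  qed
  then have BC: "AE \<alpha> in lebesgue. \<forall>\<^sub>F j in sequentially. \<alpha> \<in> space lebesgue - A j"
  proof (rule borel_cantelli_AE1[rotated 2])
    show "A j \<in> sets lebesgue" for j by (rule fmeasurableD[OF A_meas])
    show "emeasure lebesgue (A j) < \<infinity>" for j
      using fmeasurableD2[OF A_meas] unfolding infinity_ennreal_def less_top .
  qed
  \<comment> \<open>Contains every point at which \<open>nid (int_vec (e j) * \<alpha>)\<close>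
    vanishes for some \<open>j\<close>.\<close>
  define R where "R = range (\<lambda>(c :: int ^ 'd, k :: int ^ 'd). (\<chi> i. real_of_int (k $ i) / real_of_int (c $ i)) :: real ^ 'd)"
  have "countable R" by (simp add: R_def)
  then have "AE \<alpha> in lebesgue. \<alpha> \<notin> R"
    by (intro AE_not_in null_sets_completionI countable_imp_null_set_lborel)
  with BC show ?thesis
  proof eventually_elim
    case (elim \<alpha>)
    show ?case
    proof
      assume \<alpha>: "\<alpha> \<in> cbox 0 1"
      obtain J where J: "\<And>j. j \<ge> J \<Longrightarrow> \<delta> j \<le> nid (int_vec (e j) * \<alpha>)"
        using elim(1) \<alpha> unfolding eventually_sequentially A_def by (auto simp: not_less)
      have nid_pos: "0 < nid (int_vec (e j) * \<alpha>)" for j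
      proof (rule ccontr)
        assume "\<not> 0 < nid (int_vec (e j) * \<alpha>)"
        then have "nid (int_vec (e j) * \<alpha>) = 0" using nid_nonneg[of "int_vec (e j) * \<alpha>"] by linarith
        then obtain k where "infnorm (int_vec (e j) * \<alpha> + int_vec k) = 0" using nid_attained by metis
        then have k: "real_of_int (e j $ i) * \<alpha> $ i + real_of_int (k $ i) = 0" for i
          unfolding infnorm_eq_0 by (auto simp: vec_eq_iff int_vec_def)
        have "\<alpha> $ i = real_of_int ((- k) $ i) / real_of_int (e j $ i)" for i
        proof -
          have "real_of_int ((- k) $ i) = \<alpha> $ i * real_of_int (e j $ i)"
            using k[of i] by (simp add: mult.commute)
          then show ?thesis using e_pos[of j i] by simp
        qed
        then have "\<alpha> = (\<chi> i. real_of_int ((- k) $ i) / real_of_int (e j $ i))"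
          by (simp add: vec_eq_iff)
        then have "\<alpha> \<in> R" unfolding R_def by (intro range_eqI[of _ _ "(e j, - k)"]) simp
        then show False using elim(2) by simp
      qed
      obtain m where m: "0 < m" "\<And>j. j < J \<Longrightarrow> m \<le> nid (int_vec (e j) * \<alpha>)"
      proof
        \<comment> \<open>The inserted 1 covers \<open>J = 0\<close>, where the minimum would be
          over the empty set.\<close>
        define m where "m = Min (insert 1 ((\<lambda>j. nid (int_vec (e j) * \<alpha>)) ` {..<J}))"
        show "0 < m" unfolding m_def using nid_pos by (subst Min_gr_iff) auto
        show "m \<le> nid (int_vec (e j) * \<alpha>)" if "j < J" for j
          unfolding m_def using that by (intro Min_le) auto
      qed
      define t where "t N = 1 / (real (C N) * ln (real N) * ln (ln (real N)) powr (1 + d * \<epsilon>))" for N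
      have "\<forall>\<^sub>F N in sequentially. N \<ge> 17" by (rule eventually_ge_at_top)
      \<comment> \<open>The 6 is \<open>2 * 3\<close>, from \<open>j + 17 <= 2 * C N\<close> and
        \<open>ln (2 * C N) <= 3 * ln N\<close>; the latter also explains the summand
        \<open>ln 3\<close>.\<close>
      moreover have "\<forall>\<^sub>F N in sequentially. 6 * (ln 3 + ln (ln (real N))) powr (1 + \<eta>) \<le> ln (ln (real N)) powr (1 + 2 * \<eta>)"
        using \<eta> by real_asymp
      moreover have "\<forall>\<^sub>F N in sequentially. 1 / m powr d \<le> ln (real N)"
        by real_asymp
      moreover have "\<forall>\<^sub>F N in sequentially. 1 \<le> ln (ln (real N))"
        by real_asymp
      ultimately show "\<forall>\<^sub>F N in sequentially.
          min_gap_vec_seq (vec_seq a) \<alpha> N \<ge>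
            1 / (real (card_pos_diffs_vec (vec_seq a) N) powr (1 / real CARD('d))
                 * ln (real N) powr (1 / real CARD('d))
                 * ln (ln (real N)) powr (1 / real CARD('d) + \<epsilon>))"
      proof eventually_elim
        case (elim N)
        have CN: "real (C N) \<ge> 16" using C_ge[of N] elim(1) by linarith
        have lnN: "ln (real N) > 1" "ln (ln (real N)) > 0" using ln_gt_1[of "real N"] elim(1) by auto
        have target: "1 / (real (card_pos_diffs_vec (vec_seq a) N) powr (1 / real CARD('d))
                 * ln (real N) powr (1 / real CARD('d))
                 * ln (ln (real N)) powr (1 / real CARD('d) + \<epsilon>)) = t N powr (1 / d)"
          unfolding t_def d_def[symmetric] b_def[symmetric] C_eq
          using d CN lnN by (intro threshold_eq) auto
        have t_le_v: "t N \<le> v j" if "j < C N" for j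
        proof -
          have x: "16 \<le> real j + 17" "real j + 17 \<le> 2 * real (C N)" using that CN by auto
          have "ln (2 * real (C N)) \<le> ln (real N ^ 3)"
          proof (subst ln_le_cancel_iff)
            have "2 * C N \<le> 2 * N\<^sup>2" using C_le[of N] by simp
            also have "\<dots> \<le> N * N\<^sup>2" using elim(1) by (intro mult_right_mono) auto
            finally have "real (2 * C N) \<le> real (N ^ 3)" by (simp only: of_nat_le_iff power3_eq_cube power2_eq_square mult.assoc)
            then show "2 * real (C N) \<le> real N ^ 3" by simp
          qed (use CN elim(1) in auto)
          then have ln1: "ln (2 * real (C N)) \<le> 3 * ln (real N)" using elim(1) by (simp add: ln_realpow)
          have "1 < ln (2 * real (C N))" using ln_gt_1[of "2 * real (C N)"] CN by auto
          then have "ln (ln (2 * real (C N))) \<le> ln (3 * ln (real N))"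
            using ln1 lnN by (subst ln_le_cancel_iff) auto
          then have ln2: "ln (ln (2 * real (C N))) \<le> ln 3 + ln (ln (real N))"
            using lnN by (simp add: ln_mult)
          have "(real j + 17) * ln (real j + 17) * ln (ln (real j + 17)) powr (1 + \<eta>)
              \<le> 2 * real (C N) * ln (2 * real (C N)) * ln (ln (2 * real (C N))) powr (1 + \<eta>)"
            using x \<eta> by (intro bertrand_mono) auto
          also have "\<dots> \<le> 2 * real (C N) * (3 * ln (real N)) * (ln 3 + ln (ln (real N))) powr (1 + \<eta>)"
            using ln1 ln2 lnN CN \<eta> ln_gt_1[of "2 * real (C N)"]
            by (intro mult_mono powr_mono2 mult_nonneg_nonneg) auto
          also have "\<dots> = real (C N) * ln (real N) * (6 * (ln 3 + ln (ln (real N))) powr (1 + \<eta>))"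
            by simp
          also have "\<dots> \<le> real (C N) * ln (real N) * ln (ln (real N)) powr (1 + d * \<epsilon>)"
            using elim(2) lnN CN by (intro mult_left_mono) (auto simp: \<eta>_def)
          finally show ?thesis
            unfolding t_def v_def using x by (intro divide_left_mono mult_pos_pos bertrand_pos) (use CN lnN in auto)
        qed
        have t_le_m: "t N powr (1 / d) \<le> m"
        proof -
          have "1 / m powr d \<le> real (C N) * ln (real N) * ln (ln (real N)) powr (1 + d * \<epsilon>)"
          proof -
            have "1 * ln (real N) * 1 \<le> real (C N) * ln (real N) * ln (ln (real N)) powr (1 + d * \<epsilon>)"
              using CN lnN elim(4) d \<epsilon> by (intro mult_mono ge_one_powr_ge_zero) auto
            then show ?thesis using elim(3) by linarith
          qed
          then have "t N \<le> 1 / (1 / m powr d)"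
            unfolding t_def using m(1) CN lnN by (intro divide_left_mono) auto
          then have "t N powr (1 / d) \<le> (m powr d) powr (1 / d)"
            using CN lnN d by (intro powr_mono2) (auto simp: t_def)
          then show ?thesis using m(1) d by (simp add: powr_powr)
        qed
        have "t N powr (1 / d) \<le> nid (int_vec (e j) * \<alpha>)" if "j < C N" for j
        proof (cases "j < J")
          case True
          then show ?thesis using m(2)[of j] t_le_m by linarith
        next
          case False
          have "t N powr (1 / d) \<le> \<delta> j"
            unfolding \<delta>_def using t_le_v[OF that] d CN lnN by (intro powr_mono2) (auto simp: t_def)
          then show ?thesis using J[of j] False by linarith
        qed
        then have gap: "t N powr (1 / d) \<le> nid (int_vec c * \<alpha>)" if "c \<in> D N" for c
          using that by (auto simp: e(2))
        show ?case
          unfolding target min_gap_vec_seq_def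
        proof (rule min_gap_ge)
          fix m n :: nat assume mn: "1 \<le> m" "m < n" "n \<le> N"
          have "vec_seq a m $ i < vec_seq a n $ i" for i
            using strict_mono_onD[OF a[of i], of m n] mn by (simp add: vec_seq_def)
          then have "vec_seq a n - vec_seq a m \<in> D N"
            unfolding D_def b_def using mn by (intro pos_diffs_vecI imageI) auto
          moreover have "int_vec (vec_seq a n) * \<alpha> - int_vec (vec_seq a m) * \<alpha>
              = int_vec (vec_seq a n - vec_seq a m) * \<alpha>"
            by (simp add: vec_eq_iff int_vec_def left_diff_distrib)
          ultimately show "t N powr (1 / d)
              \<le> nid (frac_vec (int_vec (vec_seq a n) * \<alpha>) - frac_vec (int_vec (vec_seq a m) * \<alpha>))"
            using gap by (simp add: nid_frac_vec_diff)
        qed (use elim(1) in simp)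
      qed
    qed
  qed
qed

text \<open>Each solution \<open>q = g j\<close> supplied by \<open>gallagher\<close> is ascribed to
  the first \<open>N\<close> whose difference set contains it. At that moment \<open>N\<close> and
  \<open>C N\<close> are both at most of the order of \<open>j\<close>, so the threshold at
  \<open>j\<close> lies below the one at \<open>N\<close>.\<close>

lemma AE_min_gap_int_le:
  assumes d2: "CARD('d::finite) \<ge> 2" and a: "inj_on a {1..}"
  shows "AE \<alpha>\<in>cbox (0 :: real ^ 'd) 1 in lebesgue. \<exists>\<^sub>F N in sequentially.
          min_gap_int_seq a \<alpha> N \<le>
            1 / (real (card_pos_diffs a N) powr (1 / real CARD('d))
                 * ln (real N) powr (1 / real CARD('d))
                 * ln (ln (real N)) powr (1 / real CARD('d)))"
proof -
  define d where "d = real CARD('d)"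
  have d: "d > 0" by (simp add: d_def)
  define D where "D N = pos_diffs (a ` {1..N})" for N
  define C where "C N = card (D N)" for N
  have C_eq: "card_pos_diffs a N = C N" for N by (simp add: card_pos_diffs_def C_def D_def)
  have C_ge: "N - 1 \<le> C N" for N
    using card_pos_diffs_ge[OF a, of N] by (simp add: C_eq)
  have C_Suc: "C (Suc N) \<le> C N + N" for N using card_pos_diffs_Suc_le[of a N] by (simp add: C_eq)
  have D_mono: "mono D"
    unfolding D_def pos_diffs_def by (intro monoI) force
  have D_fin: "finite (D N)" for N
    unfolding D_def by (rule finite_subset[OF pos_diffs_subset]) auto
  have C_mono: "C M \<le> C N" if "M \<le> N" for M N
    unfolding C_def using D_mono D_fin that by (intro card_mono) (auto dest: monoD)
  have "\<exists>N. m < card (D N)" for m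
    using C_ge[of "m + 2"] by (intro exI[of _ "m + 2"]) (auto simp: C_def)
  then obtain e where e: "inj e" "\<And>N. D N = e ` {..<C N}"
    using enumerate_chain[OF D_mono D_fin] unfolding C_def by metis
  have e_pos: "e j > 0" for j
  proof -
    have "e j \<in> D (j + 2)" using C_ge[of "j + 2"] by (auto simp: e(2))
    then show ?thesis by (simp add: D_def pos_diffs_def)
  qed
  define g where "g j = nat (e j)" for j
  have g: "inj g" "int (g j) = e j" for j
    using e(1) e_pos unfolding g_def inj_def by (auto simp: less_imp_le eq_nat_nat_iff)
  \<comment> \<open>The factor 2 anticipates \<open>C N <= 2 * (j + 16)\<close>; it does not affect
    divergence.\<close>
  define w where "w j = 1 / (2 * ((real j + 16) * ln (real j + 16) * ln (ln (real j + 16))))" for j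
  have w_pos: "0 < w j" for j
    unfolding w_def using bertrand_pos[of "real j + 16" 1] ln_gt_1[of "real j + 16"] by simp
  \<comment> \<open>The value 0 rules out every \<open>q\<close> that is not a difference, because
    the inequality is strict and \<open>nid\<close> is nonnegative.\<close>
  define \<psi> where "\<psi> q = (if q \<in> range g then w (inv g q) powr (1 / d) else 0)" for q
  have \<psi>_g: "\<psi> (g j) = w j powr (1 / d)" for j using g(1) by (simp add: \<psi>_def)
  have "\<not> summable (\<lambda>q. \<psi> q ^ CARD('d))"
  proof
    assume "summable (\<lambda>q. \<psi> q ^ CARD('d))"
    then have "summable ((\<lambda>q. \<psi> q ^ CARD('d)) \<circ> g)"
      using g(1) by (intro summable_reindex) (auto simp: \<psi>_def)
    moreover have "\<psi> (g j) ^ CARD('d) = w j" for j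
      using w_pos[of j] unfolding \<psi>_g d_def by (simp add: powr_powr flip: powr_realpow)
    ultimately have "summable w" by (simp add: o_def)
    then have "summable (\<lambda>j. 2 * w j)" by (rule summable_mult)
    then show False using not_summable_bertrand by (simp add: w_def)
  qed
  moreover have "0 \<le> \<psi> q" for q by (simp add: \<psi>_def)
  ultimately have "AE \<alpha> :: real ^ 'd in lebesgue. \<exists>\<^sub>F q in sequentially. nid (real q *\<^sub>R \<alpha>) < \<psi> q"
    using d2 by (intro gallagher)
  then show ?thesis
  proof (rule AE_mp, intro AE_I2 impI)
    fix \<alpha> :: "real ^ 'd"
    assume \<alpha>: "\<exists>\<^sub>F q in sequentially. nid (real q *\<^sub>R \<alpha>) < \<psi> q"
    show "\<exists>\<^sub>F N in sequentially.
          min_gap_int_seq a \<alpha> N \<le>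
            1 / (real (card_pos_diffs a N) powr (1 / real CARD('d))
                 * ln (real N) powr (1 / real CARD('d))
                 * ln (ln (real N)) powr (1 / real CARD('d)))"
      unfolding frequently_sequentially
    proof
      fix N0 :: nat
      define M where "M = max N0 16"
      \<comment> \<open>Beyond the values of \<open>g\<close> up to \<open>C M\<close> a solution
        must have \<open>j > C M\<close>; as \<open>C\<close> is monotone, the \<open>N\<close>
        found below then exceeds \<open>M\<close>.\<close>
      obtain q where q: "q \<ge> Suc (Max (g ` {..C M}))" "nid (real q *\<^sub>R \<alpha>) < \<psi> q"
        using \<alpha> unfolding frequently_sequentially by blast
      have "\<psi> q > 0" using q(2) nid_nonneg[of "real q *\<^sub>R \<alpha>"] by linarith
      then obtain j where j: "q = g j" by (auto simp: \<psi>_def split: if_splits)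
      have "C M < j"
      proof (rule ccontr)
        assume "\<not> C M < j"
        then have "g j \<le> Max (g ` {..C M})" by (intro Max_ge) auto
        then show False using q(1) j by simp
      qed
      \<comment> \<open>By minimality the predecessor \<open>K\<close> of \<open>N\<close> has
        \<open>C K <= j\<close>, hence \<open>K <= j + 1\<close>, and one further term adds at most
        \<open>K\<close> differences.\<close>
      define N where "N = (LEAST N. j < C N)"
      have "j < C (j + 2)" using C_ge[of "j + 2"] by simp
      then have N: "j < C N" unfolding N_def by (rule LeastI)
      have least: "C n \<le> j" if "n < N" for n
        using not_less_Least[of n "\<lambda>N. j < C N"] that by (simp add: N_def)
      have "M < N" using C_mono[of N M] N \<open>C M < j\<close> by (meson leD le_less_linear less_trans)
      then obtain K where K: "N = Suc K" by (cases N) auto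
      have "C K \<le> j" using least K by simp
      then have "K \<le> j + 1" using C_ge[of K] by linarith
      then have N_le: "real N \<le> real j + 16" by (simp add: K)
      have "C N \<le> C K + K" unfolding K by (rule C_Suc)
      also have "\<dots> \<le> j + (j + 1)" using \<open>C K \<le> j\<close> \<open>K \<le> j + 1\<close> by (rule add_mono)
      finally have C_le: "real (C N) \<le> 2 * (real j + 16)" by simp
      have N16: "real N \<ge> 16" using \<open>M < N\<close> by (simp add: M_def)
      have lnN: "ln (real N) > 1" "ln (ln (real N)) > 0" using ln_gt_1[OF N16] by auto
      have C_pos: "real (C N) > 0" using N by simp
      \<comment> \<open>The exponent is written with \<open>d * 0\<close> to match
        \<open>threshold_eq\<close>.\<close>
      define t where "t = 1 / (real (C N) * ln (real N) * ln (ln (real N)) powr (1 + d * 0))"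
      have target: "1 / (real (card_pos_diffs a N) powr (1 / real CARD('d))
                 * ln (real N) powr (1 / real CARD('d))
                 * ln (ln (real N)) powr (1 / real CARD('d))) = t powr (1 / d)"
        using threshold_eq[of "real (C N)" "ln (real N)" "ln (ln (real N))" d 0] d lnN
        unfolding t_def d_def[symmetric] C_eq by simp
      have "real (C N) * ln (real N) * ln (ln (real N))
          \<le> (2 * (real j + 16)) * ln (real j + 16) * ln (ln (real j + 16))"
        using C_le N_le lnN N16 C_pos by (intro mult_mono mult_nonneg_nonneg) auto
      then have "w j \<le> t"
        unfolding w_def t_def using C_pos lnN ln_gt_1[of "real j + 16"]
        by (simp only: mult.assoc mult_zero_right add_0_right powr_one) (intro divide_left_mono mult_pos_pos, auto)
      then have "w j powr (1 / d) \<le> t powr (1 / d)"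
        using w_pos[of j] d by (intro powr_mono2) auto
      moreover have "min_gap_int_seq a \<alpha> N \<le> nid (real q *\<^sub>R \<alpha>)"
      proof -
        have "e j \<in> D N" using N by (auto simp: e(2))
        then obtain m n where mn: "m \<in> {1..N}" "n \<in> {1..N}" "e j = a n - a m"
          by (auto simp: D_def pos_diffs_def)
        then have "m \<noteq> n" using e_pos[of j] by auto
        then have "min_gap_int_seq a \<alpha> N
            \<le> nid (frac_vec (real_of_int (a n) *\<^sub>R \<alpha>) - frac_vec (real_of_int (a m) *\<^sub>R \<alpha>))"
          unfolding min_gap_int_seq_def using mn by (intro min_gap_le)
        also have "\<dots> = nid (real_of_int (a n - a m) *\<^sub>R \<alpha>)"
          by (simp add: nid_frac_vec_diff scaleR_left_diff_distrib)
        also have "real_of_int (a n - a m) = real q"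
          unfolding j mn(3)[symmetric] g(2)[of j, symmetric] by simp
        finally show ?thesis .
      qed
      ultimately have "min_gap_int_seq a \<alpha> N \<le> t powr (1 / d)"
        using q(2) by (simp add: j \<psi>_g)
      then have "min_gap_int_seq a \<alpha> N \<le> 1 / (real (card_pos_diffs a N) powr (1 / real CARD('d))
                 * ln (real N) powr (1 / real CARD('d))
                 * ln (ln (real N)) powr (1 / real CARD('d)))"
        by (simp only: target)
      moreover have "N0 \<le> N" using \<open>M < N\<close> by (simp add: M_def)
      ultimately show "\<exists>n\<ge>N0. min_gap_int_seq a \<alpha> n \<le> 1 / (real (card_pos_diffs a n) powr (1 / real CARD('d))
                 * ln (real n) powr (1 / real CARD('d))
                 * ln (ln (real n)) powr (1 / real CARD('d)))"
        by blast
    qed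
  qed
qed

theorem theorem1p1:
  fixes \<epsilon> :: real
  assumes "CARD('d::finite) \<ge> 2" and "\<epsilon> > 0"
  shows
    "(\<forall>a :: 'd \<Rightarrow> nat \<Rightarrow> nat. (\<forall>i. strict_mono_on {1..} (a i)) \<longrightarrow>
        (AE \<alpha>\<in>cbox (0 :: real ^ 'd) 1 in lebesgue. \<forall>\<^sub>F N in sequentially.
          min_gap_vec_seq (vec_seq a) \<alpha> N \<ge>
            1 / (real (card_pos_diffs_vec (vec_seq a) N) powr (1 / real CARD('d))
                 * ln (real N) powr (1 / real CARD('d))
                 * ln (ln (real N)) powr (1 / real CARD('d) + \<epsilon>)))) \<and>
     (\<forall>a :: nat \<Rightarrow> int. inj_on a {1..} \<longrightarrow>
        (AE \<alpha>\<in>cbox (0 :: real ^ 'd) 1 in lebesgue. \<exists>\<^sub>F N in sequentially.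
          min_gap_int_seq a \<alpha> N \<le>
            1 / (real (card_pos_diffs a N) powr (1 / real CARD('d))
                 * ln (real N) powr (1 / real CARD('d))
                 * ln (ln (real N)) powr (1 / real CARD('d)))))"
  using assms AE_min_gap_vec_ge AE_min_gap_int_le by blast

end
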